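(* Let $G\subset\mathrm P$ be a subset with $G+\mathrm Q\subset G$. For families $\theta=\{\theta_{ij}\}_{i,j\in I}$, $\mathbf p=(\{p_{ij}\}_{i,j\in I},\{p_i\}_{i\in I})$ of invertible elements of $\Bbbk$ satisfying $$p_{ij}^2=p_i^{2a_{ij}},\quad(p_{ij}p_{ji})/(\theta_{ij}\theta_{ji})=p_i^{2a_{ij}},\quad p_{ii}/\theta_{ii}=p_i^2,\quad 1-p_i^n\text{ invertible for all }i\in I,\ n\in\mathbb Z_{>0},\qquad(\ast)$$ the category $\mathrm{Mod}^G(U_{\theta,\mathbf p}(\mathfrak g))$ depends only on $\{p_i^2\}_{i\in I}$. That is, if $(\theta,\mathbf p)$ and $(\theta',\mathbf p')$ both satisfy $(\ast)$ and $p_i^2=p_i'^2$ for all $i\in I$, then $\mathrm{Mod}^G(U_{\theta,\mathbf p}(\mathfrak g))$ and $\mathrm{Mod}^G(U_{\theta',\mathbf p'}(\mathfrak g))$ are equivalent.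
   Context: **Cartan datum.** $I$ is an index set; $\mathsf A=(a_{ij})_{i,j\in I}$ is a symmetrizable Cartan matrix ($a_{ii}=2$, $a_{ij}\le0$ for $i\ne j$, $a_{ij}=0$ if $a_{ji}=0$, and $d_ia_{ij}=d_ja_{ji}$ for some positive integers $d_i$). $\mathrm P$ is a free abelian group, $\{\alpha_i\}\subset\mathrm P$ is linearly independent, $\{h_i\}\subset\mathrm{Hom}(\mathrm P,\mathbb Z)$, $\langle h_i,\alpha_j\rangle=a_{ij}$; $\mathrm Q=\bigoplus\mathbb Z\alpha_i$. $\Bbbk$ is a commutative ring. **$U_{\theta,\mathbf p}(\mathfrak g)$.** For $(\theta,\mathbf p)$ satisfying $(\ast)$ put $c_{ij}=p_{ij}p_i^{-a_{ij}}$. $U_{\theta,\mathbf p}(\mathfrak g)$ is the $\Bbbk$-algebra generated by $e_i,f_i,K_i^{\pm1}$ ($i\in I$) with relations $K_iK_j=K_jK_i$, $K_ie_jK_i^{-1}=p_{ij}e_j$, $K_if_jK_i^{-1}=p_{ij}^{-1}f_j$, $e_if_j-\theta_{ji}f_je_i=\delta_{ij}\frac{K_i-K_i^{-1}}{p_i-p_i^{-1}}$, and for $i\ne j$: $\sum_{k=0}^{1-a_{ij}}(-c_{ij}\theta_{ji}^{-1})^kf_i^{(1-a_{ij}-k)}f_jf_i^{(k)}=0$, $\sum_{k=0}^{1-a_{ij}}(-c_{ij}\theta_{ij})^ke_i^{(1-a_{ij}-k)}e_je_i^{(k)}=0$, where $x^{(n)}=x^n/\prod_{k=1}^n\frac{p_i^k-p_i^{-k}}{p_i-p_i^{-1}}$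 for $x=e_i,f_i$. It is $\mathrm Q$-graded with $e_i,f_i,K_i$ of degree $\alpha_i,-\alpha_i,0$. **Weighted modules.** Fix functions $\chi_i:G\to\Bbbk^\times$ with $\chi_i(\lambda)^2=p_i^{2\langle h_i,\lambda\rangle}$ and $\chi_i(\lambda+\alpha_j)=p_{ij}\chi_i(\lambda)$ (these exist, and different choices give equivalent categories). $\mathrm{Mod}^G(U_{\theta,\mathbf p}(\mathfrak g))$ is the category of modules $V=\bigoplus_{\lambda\in G}V_\lambda$ with $U_{\theta,\mathbf p}(\mathfrak g)_\alpha V_\lambda\subset V_{\lambda+\alpha}$ and $K_i|_{V_\lambda}=\chi_i(\lambda)\mathrm{id}$. *)

theory Defs
  imports
    "HOL-Library.Poly_Mapping"
    "HOL-Library.FuncSet"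
    "HOL-Algebra.QuotRing"
    "HOL-Algebra.Module"
    "HOL-Algebra.Algebraic_Closure_Type"
begin

section \<open>Categories and their equivalence\<close>

text \<open>Hom-sets of different pairs of objects need not be disjoint; hence composition and the
  arrow part of a functor take the objects involved as arguments:
  \<open>Comp C A B Z g f\<close> is \<open>g \<circ> f\<close> for \<open>f : A \<rightarrow> B\<close> and \<open>g : B \<rightarrow> Z\<close>.\<close>

record ('o, 'a) category =
  Obj :: "'o set"
  Hom :: "'o \<Rightarrow> 'o \<Rightarrow> 'a set"
  Ident :: "'o \<Rightarrow> 'a"
  Comp :: "'o \<Rightarrow> 'o \<Rightarrow> 'o \<Rightarrow> 'a \<Rightarrow> 'a \<Rightarrow> 'a"

locale category =
  fixes C :: "('o, 'a) category"
  assumes ident_hom: "A \<in> Obj C \<Longrightarrow> Ident C A \<in> Hom C A A"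
    and comp_hom: "\<lbrakk>A \<in> Obj C; B \<in> Obj C; Z \<in> Obj C; f \<in> Hom C A B; g \<in> Hom C B Z\<rbrakk>
      \<Longrightarrow> Comp C A B Z g f \<in> Hom C A Z"
    and comp_ident_right: "\<lbrakk>A \<in> Obj C; B \<in> Obj C; f \<in> Hom C A B\<rbrakk>
      \<Longrightarrow> Comp C A A B f (Ident C A) = f"
    and comp_ident_left: "\<lbrakk>A \<in> Obj C; B \<in> Obj C; f \<in> Hom C A B\<rbrakk>
      \<Longrightarrow> Comp C A B B (Ident C B) f = f"
    and comp_assoc: "\<lbrakk>W \<in> Obj C; A \<in> Obj C; B \<in> Obj C; Z \<in> Obj C;
        f \<in> Hom C W A; g \<in> Hom C A B; h \<in> Hom C B Z\<rbrakk>
      \<Longrightarrow> Comp C W B Z h (Comp C W A B g f) = Comp C W A Z (Comp C A B Z h g) f"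

locale category_functor = C: category C + D: category D
  for C :: "('o, 'a) category" and D :: "('u, 'b) category" +
  fixes Fo :: "'o \<Rightarrow> 'u" and Fm :: "'o \<Rightarrow> 'o \<Rightarrow> 'a \<Rightarrow> 'b"
  assumes obj_map: "A \<in> Obj C \<Longrightarrow> Fo A \<in> Obj D"
    and hom_map: "\<lbrakk>A \<in> Obj C; B \<in> Obj C; f \<in> Hom C A B\<rbrakk> \<Longrightarrow> Fm A B f \<in> Hom D (Fo A) (Fo B)"
    and ident_map: "A \<in> Obj C \<Longrightarrow> Fm A A (Ident C A) = Ident D (Fo A)"
    and comp_map: "\<lbrakk>A \<in> Obj C; B \<in> Obj C; Z \<in> Obj C; f \<in> Hom C A B; g \<in> Hom C B Z\<rbrakk>
      \<Longrightarrow> Fm A Z (Comp C A B Z g f) = Comp D (Fo A) (Fo B) (Fo Z) (Fm B Z g) (Fm A B f)"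

definition isomorphism_in :: "('o, 'a) category \<Rightarrow> 'o \<Rightarrow> 'o \<Rightarrow> 'a \<Rightarrow> bool" where
  "isomorphism_in C A B f \<longleftrightarrow> f \<in> Hom C A B \<and>
     (\<exists>g \<in> Hom C B A. Comp C A B A g f = Ident C A \<and> Comp C B A B f g = Ident C B)"

locale natural_isomorphism = F: category_functor C D Fo Fm + G: category_functor C D Go Gm
  for C :: "('o, 'a) category" and D :: "('u, 'b) category"
    and Fo :: "'o \<Rightarrow> 'u" and Fm :: "'o \<Rightarrow> 'o \<Rightarrow> 'a \<Rightarrow> 'b"
    and Go :: "'o \<Rightarrow> 'u" and Gm :: "'o \<Rightarrow> 'o \<Rightarrow> 'a \<Rightarrow> 'b" +
  fixes \<eta> :: "'o \<Rightarrow> 'b"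
  assumes component_iso: "A \<in> Obj C \<Longrightarrow> isomorphism_in D (Fo A) (Go A) (\<eta> A)"
    and naturality: "\<lbrakk>A \<in> Obj C; B \<in> Obj C; f \<in> Hom C A B\<rbrakk>
      \<Longrightarrow> Comp D (Fo A) (Fo B) (Go B) (\<eta> B) (Fm A B f)
        = Comp D (Fo A) (Go A) (Go B) (Gm A B f) (\<eta> A)"

definition equivalent_categories :: "('o, 'a) category \<Rightarrow> ('u, 'b) category \<Rightarrow> bool" where
  "equivalent_categories C D \<longleftrightarrow>
    (\<exists>Fo Fm Go Gm \<eta> \<epsilon>.
      category_functor C D Fo Fm \<and> category_functor D C Go Gm \<and>
      natural_isomorphism C C (\<lambda>A. A) (\<lambda>A B f. f)
        (\<lambda>A. Go (Fo A)) (\<lambda>A B f. Gm (Fo A) (Fo B) (Fm A B f)) \<eta> \<and>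
      natural_isomorphism D D (\<lambda>A. Fo (Go A)) (\<lambda>A B f. Fm (Go A) (Go B) (Gm A B f))
        (\<lambda>A. A) (\<lambda>A B f. f) \<epsilon>)"


section \<open>Cartan data\<close>

definition zmult :: "int \<Rightarrow> 'p::ab_group_add \<Rightarrow> 'p" where
  "zmult n x = (if 0 \<le> n then ((+) x ^^ nat n) 0 else - ((+) x ^^ nat (- n)) 0)"

lemma zmult_Suc: "zmult (n + 1) x = x + zmult n x"
proof (cases "0 \<le> n")
  case True
  then have "nat (n + 1) = Suc (nat n)" by simp
  with True show ?thesis by (simp add: zmult_def)
next
  case False
  then have "nat (- n) = Suc (nat (- (n + 1)))" by simp
  with False show ?thesis by (cases "n = -1") (auto simp: zmult_def)
qed

lemma zmult_pred: "zmult (n - 1) x = zmult n x - x"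
  using zmult_Suc[of "n - 1" x] by (simp add: algebra_simps)

lemma zmult_zero: "zmult 0 x = 0"
  by (simp add: zmult_def)

interpretation zmod: Modules.module "zmult :: int \<Rightarrow> 'p::ab_group_add \<Rightarrow> 'p"
proof
  fix a b :: int and x y :: 'p
  show r: "zmult a (x + y) = zmult a x + zmult a y"
    by (induction a rule: int_induct[where k = 0])
      (simp_all add: zmult_zero zmult_Suc zmult_pred algebra_simps)
  show l: "zmult (a + b) x = zmult a x + zmult b x" for a b
  proof (induction a rule: int_induct[where k = 0])
    case base
    show ?case by (simp add: zmult_zero)
  next
    case (step1 i)
    have "i + 1 + b = (i + b) + 1" by simp
    with step1 show ?case by (simp only: zmult_Suc) (simp add: algebra_simps)
  next
    case (step2 i)
    have "i - 1 + b = (i + b) - 1" by simp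
    with step2 show ?case by (simp only: zmult_pred) (simp add: algebra_simps)
  qed
  show "zmult a (zmult b x) = zmult (a * b) x"
  proof (induction a rule: int_induct[where k = 0])
    case base
    show ?case by (simp add: zmult_zero)
  next
    case (step1 i)
    have "zmult ((i + 1) * b) x = zmult (i * b) x + zmult b x"
      by (simp only: distrib_right l) simp
    with step1 show ?case by (simp only: zmult_Suc) (simp add: algebra_simps)
  next
    case (step2 i)
    have "zmult (i * b) x = zmult ((i - 1) * b + b) x" by (simp add: algebra_simps)
    then have "zmult (i * b) x = zmult ((i - 1) * b) x + zmult b x" by (simp only: l)
    with step2 show ?case by (simp only: zmult_pred) (simp add: algebra_simps)
  qed
  show "zmult 1 x = x"
    using zmult_Suc[of 0 x] by (simp add: zmult_zero)
qed

definition symmetrizable_cartan_matrix :: "('i \<Rightarrow> 'i \<Rightarrow> int) \<Rightarrow> bool" where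
  "symmetrizable_cartan_matrix a \<longleftrightarrow>
     (\<forall>i. a i i = 2) \<and> (\<forall>i j. i \<noteq> j \<longrightarrow> a i j \<le> 0) \<and> (\<forall>i j. a j i = 0 \<longrightarrow> a i j = 0) \<and>
     (\<exists>d :: 'i \<Rightarrow> int. (\<forall>i. 0 < d i) \<and> (\<forall>i j. d i * a i j = d j * a j i))"

text \<open>The weight lattice is the whole type \<open>'p\<close>.\<close>

definition cartan_datum ::
  "('i \<Rightarrow> 'i \<Rightarrow> int) \<Rightarrow> ('i \<Rightarrow> 'p::ab_group_add) \<Rightarrow> ('i \<Rightarrow> 'p \<Rightarrow> int) \<Rightarrow> bool" where
  "cartan_datum a \<alpha> h \<longleftrightarrow>
     symmetrizable_cartan_matrix a \<and>
     (\<exists>B :: 'p set. zmod.independent B \<and> zmod.span B = UNIV) \<and>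
     inj \<alpha> \<and> zmod.independent (range \<alpha>) \<and>
     (\<forall>i. additive (h i)) \<and> (\<forall>i j. h i (\<alpha> j) = a i j)"

definition root_lattice :: "('i \<Rightarrow> 'p::ab_group_add) \<Rightarrow> 'p set" where
  "root_lattice \<alpha> = zmod.span (range \<alpha>)"


section \<open>Parameters\<close>

text \<open>Inverses and integral powers of units of a commutative ring; only used for units.\<close>

definition unit_inv :: "'k::comm_ring_1 \<Rightarrow> 'k" where
  "unit_inv x = (THE y. x * y = 1)"

definition unit_powi :: "'k::comm_ring_1 \<Rightarrow> int \<Rightarrow> 'k" where
  "unit_powi x n = (if 0 \<le> n then x ^ nat n else unit_inv x ^ nat (- n))"

text \<open>\<open>pp i j\<close> is $p_{ij}$ and \<open>p i\<close> is $p_i$.\<close>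

definition admissible_parameters ::
  "('i \<Rightarrow> 'i \<Rightarrow> int) \<Rightarrow> ('i \<Rightarrow> 'i \<Rightarrow> 'k::comm_ring_1) \<Rightarrow> ('i \<Rightarrow> 'i \<Rightarrow> 'k) \<Rightarrow> ('i \<Rightarrow> 'k) \<Rightarrow> bool" where
  "admissible_parameters a \<theta> pp p \<longleftrightarrow>
     (\<forall>i j. \<theta> i j dvd 1) \<and> (\<forall>i j. pp i j dvd 1) \<and> (\<forall>i. p i dvd 1) \<and>
     (\<forall>i j. (pp i j)\<^sup>2 = unit_powi (p i) (2 * a i j)) \<and>
     (\<forall>i j. pp i j * pp j i * unit_inv (\<theta> i j * \<theta> j i) = unit_powi (p i) (2 * a i j)) \<and>
     (\<forall>i. pp i i * unit_inv (\<theta> i i) = (p i)\<^sup>2) \<and>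
     (\<forall>i. \<forall>n::nat. 0 < n \<longrightarrow> (1 - p i ^ n) dvd 1)"

text \<open>Only the values \<open>\<chi> i \<mu>\<close> with \<open>\<mu> \<in> G\<close> matter.\<close>

definition weight_characters ::
  "('i \<Rightarrow> 'p::ab_group_add) \<Rightarrow> ('i \<Rightarrow> 'p \<Rightarrow> int) \<Rightarrow> 'p set \<Rightarrow>
   ('i \<Rightarrow> 'i \<Rightarrow> 'k::comm_ring_1) \<Rightarrow> ('i \<Rightarrow> 'k) \<Rightarrow> ('i \<Rightarrow> 'p \<Rightarrow> 'k) \<Rightarrow> bool" where
  "weight_characters \<alpha> h G pp p \<chi> \<longleftrightarrow>
     (\<forall>i. \<forall>\<mu>\<in>G. \<chi> i \<mu> dvd 1 \<and> (\<chi> i \<mu>)\<^sup>2 = unit_powi (p i) (2 * h i \<mu>)) \<and>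
     (\<forall>i j. \<forall>\<mu>\<in>G. \<chi> i (\<mu> + \<alpha> j) = pp i j * \<chi> i \<mu>)"


section \<open>Free algebras\<close>

text \<open>The free monoid on \<open>'g\<close>, written additively, so that \<open>'g word \<Rightarrow>\<^sub>0 'k\<close> with the convolution
  product of \<open>Poly_Mapping\<close> is the free (noncommutative) algebra on \<open>'g\<close> over \<open>'k\<close>.\<close>

datatype 'g word = Word (letters: "'g list")

instantiation word :: (type) monoid_add
begin
definition zero_word :: "'a word" where "zero_word = Word []"
definition plus_word :: "'a word \<Rightarrow> 'a word \<Rightarrow> 'a word" where
  "plus_word v w = Word (letters v @ letters w)"
instance
  by standard (auto simp: zero_word_def plus_word_def word.expand)
end

type_synonym ('g, 'k) free_algebra = "'g word \<Rightarrow>\<^sub>0 'k"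

definition gen :: "'g \<Rightarrow> ('g, 'k::comm_ring_1) free_algebra" where
  "gen x = Poly_Mapping.single (Word [x]) 1"

definition scal :: "'k::comm_ring_1 \<Rightarrow> ('g, 'k) free_algebra" where
  "scal c = Poly_Mapping.single 0 c"


section \<open>The algebra $U_{\theta,\mathbf p}(\mathfrak g)$\<close>

datatype 'i qgen = Gen_e 'i | Gen_f 'i | Gen_K 'i | Gen_Kinv 'i

type_synonym ('i, 'k) free_alg = "('i qgen, 'k) free_algebra"
type_synonym ('i, 'k) U_elem = "('i, 'k) free_alg set"

abbreviation "ge i \<equiv> gen (Gen_e i)"
abbreviation "gf i \<equiv> gen (Gen_f i)"
abbreviation "gK i \<equiv> gen (Gen_K i)"
abbreviation "gKinv i \<equiv> gen (Gen_Kinv i)"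

definition quantum_factorial :: "'k::comm_ring_1 \<Rightarrow> nat \<Rightarrow> 'k" where
  "quantum_factorial q n =
     (\<Prod>k = 1..n. (q ^ k - unit_inv q ^ k) * unit_inv (q - unit_inv q))"

definition divided_power ::
  "'k::comm_ring_1 \<Rightarrow> ('g, 'k) free_algebra \<Rightarrow> nat \<Rightarrow> ('g, 'k) free_algebra" where
  "divided_power q x n = scal (unit_inv (quantum_factorial q n)) * x ^ n"

definition serre_coeff ::
  "('i \<Rightarrow> 'i \<Rightarrow> int) \<Rightarrow> ('i \<Rightarrow> 'i \<Rightarrow> 'k::comm_ring_1) \<Rightarrow> ('i \<Rightarrow> 'k) \<Rightarrow> 'i \<Rightarrow> 'i \<Rightarrow> 'k" where
  "serre_coeff a pp p i j = pp i j * unit_powi (p i) (- a i j)"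

text \<open>\<open>serre q N t x y\<close> is $\sum_{k=0}^{N} t^k x^{(N-k)} y x^{(k)}$, with divided powers formed
  with respect to \<open>q\<close>.\<close>

definition serre ::
  "'k::comm_ring_1 \<Rightarrow> nat \<Rightarrow> 'k \<Rightarrow> ('g, 'k) free_algebra \<Rightarrow> ('g, 'k) free_algebra \<Rightarrow> ('g, 'k) free_algebra" where
  "serre q N t x y =
     (\<Sum>k = 0..N. scal (t ^ k) * divided_power q x (N - k) * y * divided_power q x k)"

text \<open>A relation \<open>l = r\<close> is listed as the element \<open>l - r\<close>.\<close>

definition U_relations ::
  "('i \<Rightarrow> 'i \<Rightarrow> int) \<Rightarrow> ('i \<Rightarrow> 'i \<Rightarrow> 'k::comm_ring_1) \<Rightarrow> ('i \<Rightarrow> 'i \<Rightarrow> 'k) \<Rightarrow> ('i \<Rightarrow> 'k)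
   \<Rightarrow> ('i, 'k) free_alg set" where
  "U_relations a \<theta> pp p =
     {gK i * gKinv i - 1 | i. True} \<union>
     {gKinv i * gK i - 1 | i. True} \<union>
     {gK i * gK j - gK j * gK i | i j. True} \<union>
     {gK i * ge j * gKinv i - scal (pp i j) * ge j | i j. True} \<union>
     {gK i * gf j * gKinv i - scal (unit_inv (pp i j)) * gf j | i j. True} \<union>
     {ge i * gf j - scal (\<theta> j i) * gf j * ge i
        - (if i = j then scal (unit_inv (p i - unit_inv (p i))) * (gK i - gKinv i) else 0)
      | i j. True} \<union>
     {serre (p i) (nat (1 - a i j)) (- serre_coeff a pp p i j * unit_inv (\<theta> j i)) (gf i) (gf j)
      | i j. i \<noteq> j} \<union>
     {serre (p i) (nat (1 - a i j)) (- serre_coeff a pp p i j * \<theta> i j) (ge i) (ge j)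
      | i j. i \<noteq> j}"

definition U_ideal ::
  "('i \<Rightarrow> 'i \<Rightarrow> int) \<Rightarrow> ('i \<Rightarrow> 'i \<Rightarrow> 'k::comm_ring_1) \<Rightarrow> ('i \<Rightarrow> 'i \<Rightarrow> 'k) \<Rightarrow> ('i \<Rightarrow> 'k)
   \<Rightarrow> ('i, 'k) free_alg set" where
  "U_ideal a \<theta> pp p = Idl\<^bsub>ring_of_type_algebra\<^esub> (U_relations a \<theta> pp p)"

definition U_alg ::
  "('i \<Rightarrow> 'i \<Rightarrow> int) \<Rightarrow> ('i \<Rightarrow> 'i \<Rightarrow> 'k::comm_ring_1) \<Rightarrow> ('i \<Rightarrow> 'i \<Rightarrow> 'k) \<Rightarrow> ('i \<Rightarrow> 'k)
   \<Rightarrow> ('i, 'k) U_elem ring" where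
  "U_alg a \<theta> pp p = ring_of_type_algebra Quot U_ideal a \<theta> pp p"

definition U_class ::
  "('i \<Rightarrow> 'i \<Rightarrow> int) \<Rightarrow> ('i \<Rightarrow> 'i \<Rightarrow> 'k::comm_ring_1) \<Rightarrow> ('i \<Rightarrow> 'i \<Rightarrow> 'k) \<Rightarrow> ('i \<Rightarrow> 'k)
   \<Rightarrow> ('i, 'k) free_alg \<Rightarrow> ('i, 'k) U_elem" where
  "U_class a \<theta> pp p x = U_ideal a \<theta> pp p +>\<^bsub>ring_of_type_algebra\<^esub> x"

primrec gen_degree :: "('i \<Rightarrow> 'p::ab_group_add) \<Rightarrow> 'i qgen \<Rightarrow> 'p" where
  "gen_degree \<alpha> (Gen_e i) = \<alpha> i"
| "gen_degree \<alpha> (Gen_f i) = - \<alpha> i"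
| "gen_degree \<alpha> (Gen_K i) = 0"
| "gen_degree \<alpha> (Gen_Kinv i) = 0"

definition word_degree :: "('i \<Rightarrow> 'p::ab_group_add) \<Rightarrow> 'i qgen word \<Rightarrow> 'p" where
  "word_degree \<alpha> w = sum_list (map (gen_degree \<alpha>) (letters w))"

text \<open>The grading of the quotient: the image of the homogeneous elements of the free algebra.\<close>

definition U_component ::
  "('i \<Rightarrow> 'p::ab_group_add) \<Rightarrow> ('i \<Rightarrow> 'i \<Rightarrow> int) \<Rightarrow> ('i \<Rightarrow> 'i \<Rightarrow> 'k::comm_ring_1) \<Rightarrow> ('i \<Rightarrow> 'i \<Rightarrow> 'k)
   \<Rightarrow> ('i \<Rightarrow> 'k) \<Rightarrow> 'p \<Rightarrow> ('i, 'k) U_elem set" where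
  "U_component \<alpha> a \<theta> pp p \<beta> =
     U_class a \<theta> pp p ` {x. \<forall>w \<in> Poly_Mapping.keys x. word_degree \<alpha> w = \<beta>}"


section \<open>The category of weighted modules\<close>

text \<open>The library's \<open>module\<close> locale requires a commutative base ring.\<close>

locale left_module = R?: ring R + M?: abelian_group M
  for R :: "('r, 'c) ring_scheme" (structure) and M :: "('r, 'm, 'd) module_scheme" (structure) +
  assumes smult_closed:
      "\<lbrakk>x \<in> carrier R; v \<in> carrier M\<rbrakk> \<Longrightarrow> x \<odot>\<^bsub>M\<^esub> v \<in> carrier M"
    and smult_l_distr:
      "\<lbrakk>x \<in> carrier R; y \<in> carrier R; v \<in> carrier M\<rbrakk>
       \<Longrightarrow> (x \<oplus>\<^bsub>R\<^esub> y) \<odot>\<^bsub>M\<^esub> v = x \<odot>\<^bsub>M\<^esub> v \<oplus>\<^bsub>M\<^esub> y \<odot>\<^bsub>M\<^esub> v"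
    and smult_r_distr:
      "\<lbrakk>x \<in> carrier R; v \<in> carrier M; w \<in> carrier M\<rbrakk>
       \<Longrightarrow> x \<odot>\<^bsub>M\<^esub> (v \<oplus>\<^bsub>M\<^esub> w) = x \<odot>\<^bsub>M\<^esub> v \<oplus>\<^bsub>M\<^esub> x \<odot>\<^bsub>M\<^esub> w"
    and smult_assoc:
      "\<lbrakk>x \<in> carrier R; y \<in> carrier R; v \<in> carrier M\<rbrakk>
       \<Longrightarrow> (x \<otimes>\<^bsub>R\<^esub> y) \<odot>\<^bsub>M\<^esub> v = x \<odot>\<^bsub>M\<^esub> (y \<odot>\<^bsub>M\<^esub> v)"
    and smult_one: "v \<in> carrier M \<Longrightarrow> \<one>\<^bsub>R\<^esub> \<odot>\<^bsub>M\<^esub> v = v"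

definition left_module_hom ::
  "('r, 'c) ring_scheme \<Rightarrow> ('r, 'm, 'd) module_scheme \<Rightarrow> ('r, 'n, 'e) module_scheme
   \<Rightarrow> ('m \<Rightarrow> 'n) set" where
  "left_module_hom R M N =
     {f \<in> carrier M \<rightarrow>\<^sub>E carrier N.
        (\<forall>v\<in>carrier M. \<forall>w\<in>carrier M. f (v \<oplus>\<^bsub>M\<^esub> w) = f v \<oplus>\<^bsub>N\<^esub> f w) \<and>
        (\<forall>x\<in>carrier R. \<forall>v\<in>carrier M. f (x \<odot>\<^bsub>M\<^esub> v) = x \<odot>\<^bsub>N\<^esub> f v)}"

definition internal_direct_sum ::
  "('m, 'd) ring_scheme \<Rightarrow> 'p set \<Rightarrow> ('p \<Rightarrow> 'm set) \<Rightarrow> bool" where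
  "internal_direct_sum M G V \<longleftrightarrow>
     (\<forall>\<mu>\<in>G. additive_subgroup (V \<mu>) M) \<and>
     (\<forall>v\<in>carrier M. \<exists>!x. x \<in> (\<Pi>\<^sub>E \<mu>\<in>G. V \<mu>) \<and> finite {\<mu>\<in>G. x \<mu> \<noteq> \<zero>\<^bsub>M\<^esub>} \<and>
        v = finsum M x {\<mu>\<in>G. x \<mu> \<noteq> \<zero>\<^bsub>M\<^esub>})"

text \<open>An object is a module together with its family of weight spaces. The condition
  \<open>V \<mu> = {\<zero>}\<close> for \<open>\<mu> \<notin> G\<close> only fixes the irrelevant values of that family. The weight
  spaces are \<open>'k\<close>-submodules since \<open>'k\<close> acts through the degree \<open>0\<close> component. The \<open>mult\<close> and
  \<open>one\<close> fields that the record type \<open>module\<close> inherits from \<open>ring\<close> are unused.\<close>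

type_synonym ('i, 'k, 'p, 'm) weighted_module =
  "(('i, 'k) U_elem, 'm) module \<times> ('p \<Rightarrow> 'm set)"

definition is_weighted_module ::
  "'p set \<Rightarrow> ('i \<Rightarrow> 'p::ab_group_add) \<Rightarrow> ('i \<Rightarrow> 'i \<Rightarrow> int) \<Rightarrow> ('i \<Rightarrow> 'i \<Rightarrow> 'k::comm_ring_1)
   \<Rightarrow> ('i \<Rightarrow> 'i \<Rightarrow> 'k) \<Rightarrow> ('i \<Rightarrow> 'k) \<Rightarrow> ('i \<Rightarrow> 'p \<Rightarrow> 'k) \<Rightarrow> ('i, 'k, 'p, 'm) weighted_module \<Rightarrow> bool"
  where
  "is_weighted_module G \<alpha> a \<theta> pp p \<chi> = (\<lambda>(M, V).
     left_module (U_alg a \<theta> pp p) M \<and>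
     internal_direct_sum M G V \<and> (\<forall>\<mu>. \<mu> \<notin> G \<longrightarrow> V \<mu> = {\<zero>\<^bsub>M\<^esub>}) \<and>
     (\<forall>\<beta>\<in>root_lattice \<alpha>. \<forall>\<mu>\<in>G. \<forall>u\<in>U_component \<alpha> a \<theta> pp p \<beta>. \<forall>v\<in>V \<mu>. u \<odot>\<^bsub>M\<^esub> v \<in> V (\<mu> + \<beta>)) \<and>
     (\<forall>i. \<forall>\<mu>\<in>G. \<forall>v\<in>V \<mu>.
        U_class a \<theta> pp p (gK i) \<odot>\<^bsub>M\<^esub> v = U_class a \<theta> pp p (scal (\<chi> i \<mu>)) \<odot>\<^bsub>M\<^esub> v))"

definition weighted_module_hom ::
  "'p set \<Rightarrow> ('i \<Rightarrow> 'i \<Rightarrow> int) \<Rightarrow> ('i \<Rightarrow> 'i \<Rightarrow> 'k::comm_ring_1) \<Rightarrow> ('i \<Rightarrow> 'i \<Rightarrow> 'k) \<Rightarrow> ('i \<Rightarrow> 'k)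
   \<Rightarrow> ('i, 'k, 'p, 'm) weighted_module \<Rightarrow> ('i, 'k, 'p, 'm) weighted_module \<Rightarrow> ('m \<Rightarrow> 'm) set"
  where
  "weighted_module_hom G a \<theta> pp p A B =
     {f \<in> left_module_hom (U_alg a \<theta> pp p) (fst A) (fst B). \<forall>\<mu>\<in>G. f ` snd A \<mu> \<subseteq> snd B \<mu>}"

text \<open>The type \<open>'m\<close> plays the role of the universe: the objects are the weighted modules whose
  underlying set is a subset of \<open>'m\<close>.\<close>

definition weighted_module_category ::
  "'p set \<Rightarrow> ('i \<Rightarrow> 'p::ab_group_add) \<Rightarrow> ('i \<Rightarrow> 'i \<Rightarrow> int) \<Rightarrow> ('i \<Rightarrow> 'i \<Rightarrow> 'k::comm_ring_1)
   \<Rightarrow> ('i \<Rightarrow> 'i \<Rightarrow> 'k) \<Rightarrow> ('i \<Rightarrow> 'k) \<Rightarrow> ('i \<Rightarrow> 'p \<Rightarrow> 'k)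
   \<Rightarrow> (('i, 'k, 'p, 'm) weighted_module, 'm \<Rightarrow> 'm) category" where
  "weighted_module_category G \<alpha> a \<theta> pp p \<chi> =
     \<lparr>Obj = {A. is_weighted_module G \<alpha> a \<theta> pp p \<chi> A},
      Hom = weighted_module_hom G a \<theta> pp p,
      Ident = (\<lambda>A. restrict id (carrier (fst A))),
      Comp = (\<lambda>A B Z g f. compose (carrier (fst A)) g f)\<rparr>"

end

theory Submission
  imports Defs
begin

text \<open>The action on a weighted module is rescaled weight by weight: on the weight space of weight
  \<open>\<mu>\<close>, let $e_i$, $f_i$, $K_i^{\pm1}$ act by $x_i(\mu)$, $y_i(\mu)$, $\epsilon_i(\mu)$ times the
  old operators, where $\epsilon_i = \chi'_i / \chi_i$ takes values with square $1$. If
  $x_i(\mu+\alpha_j) = A_{ij} x_i(\mu)$ for units with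
  $A_{ij}/A_{ji} = (p'_{ji} \theta_{ji}) / (p_{ji} \theta'_{ji})$, and
  $y_i(\mu+\alpha_i) x_i(\mu) = \epsilon_i(\mu+\alpha_i) p'_i / p_i$, then rescaling turns every primed
  defining relation into a scalar multiple of the corresponding unprimed one, so the new operators
  define a module over the primed algebra. The matrix $A$ exists because the right-hand side is
  inverted by exchanging $i$ and $j$; the functions $x_i$ exist because the roots are linearly
  independent. Inverting all the scalars gives the inverse functor, and both composites are the
  identity up to the values of the scalar multiplication outside the carrier.\<close>


section \<open>Units\<close>

lemma unit_inv_unique: "x * y = 1 \<Longrightarrow> unit_inv x = (y :: 'k::comm_ring_1)"
  unfolding unit_inv_def by (rule the_equality) (auto, metis mult.assoc mult.commute mult_1)

lemma unit_inv_right: "(x :: 'k::comm_ring_1) dvd 1 \<Longrightarrow> x * unit_inv x = 1"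
  by (metis dvd_def unit_inv_unique)

lemma unit_inv_left: "(x :: 'k::comm_ring_1) dvd 1 \<Longrightarrow> unit_inv x * x = 1"
  by (metis unit_inv_right mult.commute)

lemma unit_inv_unit: "(x :: 'k::comm_ring_1) dvd 1 \<Longrightarrow> unit_inv x dvd 1"
  by (metis unit_inv_left dvd_triv_left)

lemma unit_inv_mult:
  "\<lbrakk>(x :: 'k::comm_ring_1) dvd 1; y dvd 1\<rbrakk> \<Longrightarrow> unit_inv (x * y) = unit_inv x * unit_inv y"
proof (rule unit_inv_unique)
  assume "x dvd 1" "y dvd 1"
  have "x * y * (unit_inv x * unit_inv y) = (x * unit_inv x) * (y * unit_inv y)"
    by (simp add: ac_simps)
  with \<open>x dvd 1\<close> \<open>y dvd 1\<close> show "x * y * (unit_inv x * unit_inv y) = 1"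
    by (simp add: unit_inv_right)
qed

lemma unit_inv_power: "(x :: 'k::comm_ring_1) dvd 1 \<Longrightarrow> unit_inv (x ^ n) = unit_inv x ^ n"
  by (rule unit_inv_unique) (metis power_mult_distrib power_one unit_inv_right)

lemma unit_mult: "\<lbrakk>(x :: 'k::comm_ring_1) dvd 1; y dvd 1\<rbrakk> \<Longrightarrow> x * y dvd 1"
  by (metis mult_dvd_mono mult_1)

lemma unit_left_cancel: "\<lbrakk>(x :: 'k::comm_ring_1) dvd 1; x * y = x * z\<rbrakk> \<Longrightarrow> y = z"
  by (metis mult.assoc mult_1 unit_inv_left)

lemma sign_unit: "(s :: 'k::comm_ring_1)\<^sup>2 = 1 \<Longrightarrow> s dvd 1"
  by (metis dvd_triv_left power2_eq_square)

lemma unit_inv_sign: "(s :: 'k::comm_ring_1)\<^sup>2 = 1 \<Longrightarrow> unit_inv s = s"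
  by (rule unit_inv_unique) (simp add: power2_eq_square)

lemma unit_powi_double:
  assumes "(x :: 'k::comm_ring_1) dvd 1"
  shows "unit_powi x (2 * n) = unit_powi (x\<^sup>2) n"
  using assms by (simp add: unit_powi_def unit_inv_power nat_mult_distrib power_mult
      flip: mult_minus_right)


section \<open>Twisting words\<close>

text \<open>Words act from right to left: when the letter \<open>g\<close> acts, \<open>gs\<close>
  has already moved the weight by its degree, and the factor of \<open>g\<close> is taken at the
  weight reached.\<close>

primrec list_twist :: "('i \<Rightarrow> 'p::ab_group_add) \<Rightarrow> ('i qgen \<Rightarrow> 'p \<Rightarrow> 'k::comm_ring_1) \<Rightarrow> 'p
    \<Rightarrow> 'i qgen list \<Rightarrow> 'k" where
  "list_twist \<alpha> c \<mu> [] = 1"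
| "list_twist \<alpha> c \<mu> (g # gs) = c g (\<mu> + word_degree \<alpha> (Word gs)) * list_twist \<alpha> c \<mu> gs"

definition word_twist :: "('i \<Rightarrow> 'p::ab_group_add) \<Rightarrow> ('i qgen \<Rightarrow> 'p \<Rightarrow> 'k::comm_ring_1) \<Rightarrow> 'p
    \<Rightarrow> 'i qgen word \<Rightarrow> 'k" where
  "word_twist \<alpha> c \<mu> w = list_twist \<alpha> c \<mu> (letters w)"

definition twist :: "('i \<Rightarrow> 'p::ab_group_add) \<Rightarrow> ('i qgen \<Rightarrow> 'p \<Rightarrow> 'k::comm_ring_1) \<Rightarrow> 'p
    \<Rightarrow> ('i, 'k) free_alg \<Rightarrow> ('i, 'k) free_alg" where
  "twist \<alpha> c \<mu> x = Poly_Mapping.mapp (\<lambda>w k. word_twist \<alpha> c \<mu> w * k) x"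

lemma word_degree_zero [simp]: "word_degree \<alpha> 0 = 0"
  by (simp add: word_degree_def zero_word_def)

lemma word_degree_add [simp]: "word_degree \<alpha> (v + w) = word_degree \<alpha> v + word_degree \<alpha> w"
  by (simp add: word_degree_def plus_word_def)

lemma word_degree_Cons: "word_degree \<alpha> (Word (g # gs)) = gen_degree \<alpha> g + word_degree \<alpha> (Word gs)"
  by (simp add: word_degree_def)

lemma word_degree_Nil [simp]: "word_degree \<alpha> (Word []) = 0"
  by (simp add: word_degree_def)

lemma word_twist_zero [simp]: "word_twist \<alpha> c \<mu> 0 = 1"
  by (simp add: word_twist_def zero_word_def)

lemma word_twist_Cons:
  "word_twist \<alpha> c \<mu> (Word (g # gs)) = c g (\<mu> + word_degree \<alpha> (Word gs)) * word_twist \<alpha> c \<mu> (Word gs)"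
  by (simp add: word_twist_def)

lemma word_twist_Nil [simp]: "word_twist \<alpha> c \<mu> (Word []) = 1"
  by (simp add: word_twist_def)

text \<open>A cocycle rule: \<open>w\<close> acts first, so \<open>v\<close> starts at the shifted
  weight.\<close>

lemma word_twist_add:
  "word_twist \<alpha> c \<mu> (v + w) = word_twist \<alpha> c (\<mu> + word_degree \<alpha> w) v * word_twist \<alpha> c \<mu> w"
proof -
  have "list_twist \<alpha> c \<mu> (xs @ ys)
      = list_twist \<alpha> c (\<mu> + word_degree \<alpha> (Word ys)) xs * list_twist \<alpha> c \<mu> ys" for xs ys
    by (induction xs) (auto simp: ac_simps word_degree_def)
  then show ?thesis by (simp add: word_twist_def plus_word_def)
qed

lemma lookup_twist:
  "Poly_Mapping.lookup (twist \<alpha> c \<mu> x) w = word_twist \<alpha> c \<mu> w * Poly_Mapping.lookup x w"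
  by (simp add: twist_def mapp.rep_eq when_def in_keys_iff)

lemma twist_single [simp]:
  "twist \<alpha> c \<mu> (Poly_Mapping.single w k) = Poly_Mapping.single w (word_twist \<alpha> c \<mu> w * k)"
  by (rule poly_mapping_eqI) (simp add: lookup_twist lookup_single when_def)

lemma twist_zero [simp]: "twist \<alpha> c \<mu> 0 = 0"
  by (rule poly_mapping_eqI) (simp add: lookup_twist)

lemma twist_add: "twist \<alpha> c \<mu> (x + y) = twist \<alpha> c \<mu> x + twist \<alpha> c \<mu> y"
  by (rule poly_mapping_eqI) (simp add: lookup_twist lookup_add algebra_simps)

lemma twist_diff: "twist \<alpha> c \<mu> (x - y) = twist \<alpha> c \<mu> x - twist \<alpha> c \<mu> y"
  by (rule poly_mapping_eqI) (simp add: lookup_twist lookup_minus algebra_simps)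

lemma twist_sum: "twist \<alpha> c \<mu> (sum f S) = (\<Sum>s\<in>S. twist \<alpha> c \<mu> (f s))"
  by (induction S rule: infinite_finite_induct) (simp_all add: twist_add)

lemma twist_twist:
  assumes "\<And>w. word_twist \<alpha> c \<mu> w * word_twist \<alpha> d \<mu> w = 1"
  shows "twist \<alpha> c \<mu> (twist \<alpha> d \<mu> x) = x"
  by (rule poly_mapping_eqI) (simp add: lookup_twist assms flip: mult.assoc)

lemma keys_twist: "Poly_Mapping.keys (twist \<alpha> c \<mu> x) \<subseteq> Poly_Mapping.keys x"
  by (auto simp: in_keys_iff lookup_twist)

lemma poly_mapping_additive_induct [case_names zero single add]:
  assumes "P 0" "\<And>w k. P (Poly_Mapping.single w k)" "\<And>x y. P x \<Longrightarrow> P y \<Longrightarrow> P (x + y)"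
  shows "P (x :: 'a \<Rightarrow>\<^sub>0 'b::monoid_add)"
proof (induction x rule: update_induct)
  case const
  show ?case by fact
next
  case (update f w k)
  \<comment> \<open>Here \<open>w\<close> is not a key of \<open>f\<close>, so the value overwritten
    by \<open>update\<close> is 0.\<close>
  have "Poly_Mapping.update w k f = f + Poly_Mapping.single w k"
    using update by (intro poly_mapping_eqI) (auto simp: lookup_update lookup_add lookup_single in_keys_iff)
  with update assms show ?case by metis
qed

section \<open>Homogeneous elements and the product rule for twisting\<close>

definition homogeneous :: "('i \<Rightarrow> 'p::ab_group_add) \<Rightarrow> 'p \<Rightarrow> ('i, 'k::comm_ring_1) free_alg \<Rightarrow> bool" where
  "homogeneous \<alpha> \<beta> x \<longleftrightarrow> (\<forall>w \<in> Poly_Mapping.keys x. word_degree \<alpha> w = \<beta>)"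

lemma homogeneous_single: "homogeneous \<alpha> (word_degree \<alpha> w) (Poly_Mapping.single w k)"
  by (simp add: homogeneous_def)

lemma homogeneous_twist: "homogeneous \<alpha> \<beta> x \<Longrightarrow> homogeneous \<alpha> \<beta> (twist \<alpha> c \<mu> x)"
  using keys_twist by (fastforce simp: homogeneous_def)

lemma twist_mult_single:
  "twist \<alpha> c \<mu> (x * Poly_Mapping.single w k)
    = twist \<alpha> c (\<mu> + word_degree \<alpha> w) x * twist \<alpha> c \<mu> (Poly_Mapping.single w k)"
  by (induction x rule: poly_mapping_additive_induct)
    (simp_all add: mult_single word_twist_add twist_add distrib_right ac_simps)

lemma eq_sum_single:
  fixes x :: "('i, 'k::comm_ring_1) free_alg"
  shows "x = (\<Sum>w\<in>Poly_Mapping.keys x. Poly_Mapping.single w (Poly_Mapping.lookup x w))"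
  by (rule poly_mapping_eqI) (simp add: lookup_sum lookup_single when_def in_keys_iff)

text \<open>The left factor is twisted at the weight reached after \<open>y\<close> has acted. There
  is one such weight because all words of \<open>y\<close> have the same degree; the words of
  \<open>x\<close> may have different degrees.\<close>

lemma twist_mult:
  assumes "homogeneous \<alpha> \<beta> y"
  shows "twist \<alpha> c \<mu> (x * y) = twist \<alpha> c (\<mu> + \<beta>) x * twist \<alpha> c \<mu> y"
proof -
  have "twist \<alpha> c \<mu> (x * (\<Sum>w\<in>Poly_Mapping.keys y. Poly_Mapping.single w (Poly_Mapping.lookup y w)))
    = twist \<alpha> c (\<mu> + \<beta>) x
      * twist \<alpha> c \<mu> (\<Sum>w\<in>Poly_Mapping.keys y. Poly_Mapping.single w (Poly_Mapping.lookup y w))"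
    unfolding sum_distrib_left twist_sum
  proof (rule sum.cong)
    fix w assume "w \<in> Poly_Mapping.keys y"
    then have "word_degree \<alpha> w = \<beta>" using assms by (simp add: homogeneous_def)
    then show "twist \<alpha> c \<mu> (x * Poly_Mapping.single w (Poly_Mapping.lookup y w))
      = twist \<alpha> c (\<mu> + \<beta>) x * twist \<alpha> c \<mu> (Poly_Mapping.single w (Poly_Mapping.lookup y w))"
      by (simp only: twist_mult_single)
  qed simp
  then show ?thesis by (simp only: eq_sum_single[symmetric])
qed

lemma homogeneous_zero [simp]: "homogeneous \<alpha> \<beta> 0"
  by (simp add: homogeneous_def)

lemma homogeneous_add: "\<lbrakk>homogeneous \<alpha> \<beta> x; homogeneous \<alpha> \<beta> y\<rbrakk> \<Longrightarrow> homogeneous \<alpha> \<beta> (x + y)"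
  using keys_add[of x y] by (auto simp: homogeneous_def)

lemma homogeneous_diff: "\<lbrakk>homogeneous \<alpha> \<beta> x; homogeneous \<alpha> \<beta> y\<rbrakk> \<Longrightarrow> homogeneous \<alpha> \<beta> (x - y)"
  unfolding homogeneous_def by (metis in_keys_iff lookup_minus diff_self right_minus_eq)

lemma homogeneous_sum: "(\<And>s. s \<in> S \<Longrightarrow> homogeneous \<alpha> \<beta> (f s)) \<Longrightarrow> homogeneous \<alpha> \<beta> (sum f S)"
  by (induction S rule: infinite_finite_induct) (auto intro: homogeneous_add)

lemma homogeneous_gen: "homogeneous \<alpha> (gen_degree \<alpha> g) (gen g)"
  by (simp add: homogeneous_def gen_def word_degree_def)

lemma homogeneous_scal: "homogeneous \<alpha> 0 (scal k)"
  by (simp add: homogeneous_def scal_def)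

lemma homogeneous_mult:
  assumes "homogeneous \<alpha> \<beta> x" "homogeneous \<alpha> \<gamma> y"
  shows "homogeneous \<alpha> (\<beta> + \<gamma>) (x * y)"
  using keys_mult[of x y] assms by (fastforce simp: homogeneous_def)

section \<open>Scalars and generators under twisting\<close>

lemma scal_mult: "scal (k * l) = scal k * scal l"
  by (simp add: scal_def mult_single)

lemma scal_one [simp]: "scal 1 = 1"
  by (simp add: scal_def)

lemma scal_mult_single: "scal k * Poly_Mapping.single w l = Poly_Mapping.single w (k * l)"
  by (simp add: scal_def mult_single)

lemma single_mult_scal: "Poly_Mapping.single w l * scal k = Poly_Mapping.single w (k * l)"
  by (simp add: scal_def mult_single ac_simps)

lemma scal_commute: "x * scal k = scal k * x"
  by (induction x rule: poly_mapping_additive_induct)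
    (simp_all add: scal_mult_single single_mult_scal distrib_left distrib_right)

lemma twist_scal [simp]: "twist \<alpha> c \<mu> (scal k) = scal k"
  by (simp add: scal_def)

lemma twist_one [simp]: "twist \<alpha> c \<mu> 1 = 1"
  using twist_scal[of \<alpha> c \<mu> 1] by simp

lemma twist_gen: "twist \<alpha> c \<mu> (gen g) = scal (c g \<mu>) * gen g"
  by (simp add: gen_def scal_mult_single word_twist_Cons)

lemma twist_mult_gen:
  "twist \<alpha> c \<mu> (x * gen g) = scal (c g \<mu>) * twist \<alpha> c (\<mu> + gen_degree \<alpha> g) x * gen g"
  by (simp add: twist_mult[OF homogeneous_gen] twist_gen mult.assoc[symmetric] scal_commute)

lemma twist_scal_mult: "twist \<alpha> c \<mu> (scal k * x) = scal k * twist \<alpha> c \<mu> x"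
  by (induction x rule: poly_mapping_additive_induct)
    (simp_all add: scal_mult_single distrib_left twist_add ac_simps)

lemma ring_of_algebra: "ring (ring_of_type_algebra :: 'a::ring_1 ring)"
proof -
  have "\<exists>y. x + y = 0" for x :: 'a
    using right_minus by blast
  then show ?thesis
    unfolding ring_of_type_algebra_def
    by unfold_locales (auto simp: algebra_simps Units_def)
qed


section \<open>The defining ideal\<close>

lemma ideal_U_ideal: "ideal (U_ideal a \<theta> pp p) ring_of_type_algebra"
  unfolding U_ideal_def
  by (rule ring.genideal_ideal[OF ring_of_algebra]) (simp add: ring_of_type_algebra_def)

lemma U_relations_in_ideal: "x \<in> U_relations a \<theta> pp p \<Longrightarrow> x \<in> U_ideal a \<theta> pp p"
  unfolding U_ideal_def
  using ring.genideal_self[OF ring_of_algebra] by (fastforce simp: ring_of_type_algebra_def)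

lemma U_ideal_relations:
  "gK i * gKinv i - 1 \<in> U_ideal a \<theta> pp p"
  "gKinv i * gK i - 1 \<in> U_ideal a \<theta> pp p"
  "gK i * gK j - gK j * gK i \<in> U_ideal a \<theta> pp p"
  "gK i * ge j * gKinv i - scal (pp i j) * ge j \<in> U_ideal a \<theta> pp p"
  "gK i * gf j * gKinv i - scal (unit_inv (pp i j)) * gf j \<in> U_ideal a \<theta> pp p"
  "ge i * gf j - scal (\<theta> j i) * gf j * ge i
      - (if i = j then scal (unit_inv (p i - unit_inv (p i))) * (gK i - gKinv i) else 0) \<in> U_ideal a \<theta> pp p"
  "i \<noteq> j \<Longrightarrow> serre (p i) (nat (1 - a i j)) (- serre_coeff a pp p i j * unit_inv (\<theta> j i)) (gf i) (gf j)
      \<in> U_ideal a \<theta> pp p"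
  "i \<noteq> j \<Longrightarrow> serre (p i) (nat (1 - a i j)) (- serre_coeff a pp p i j * \<theta> i j) (ge i) (ge j)
      \<in> U_ideal a \<theta> pp p"
  by (rule U_relations_in_ideal; unfold U_relations_def; blast)+

lemma U_ideal_zero: "0 \<in> U_ideal a \<theta> pp p"
  and U_ideal_add: "\<lbrakk>x \<in> U_ideal a \<theta> pp p; y \<in> U_ideal a \<theta> pp p\<rbrakk> \<Longrightarrow> x + y \<in> U_ideal a \<theta> pp p"
  and U_ideal_mult_left: "x \<in> U_ideal a \<theta> pp p \<Longrightarrow> z * x \<in> U_ideal a \<theta> pp p"
  and U_ideal_mult_right: "x \<in> U_ideal a \<theta> pp p \<Longrightarrow> x * z \<in> U_ideal a \<theta> pp p"
  using ideal_U_ideal[of a \<theta> pp p]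
    additive_subgroup.zero_closed[OF ideal.axioms(1)[OF ideal_U_ideal[of a \<theta> pp p]]]
    additive_subgroup.a_closed[OF ideal.axioms(1)[OF ideal_U_ideal[of a \<theta> pp p]]]
    ideal.I_l_closed[OF ideal_U_ideal[of a \<theta> pp p]] ideal.I_r_closed[OF ideal_U_ideal[of a \<theta> pp p]]
  by (simp_all add: ring_of_type_algebra_def)

text \<open>Twisting is multiplicative only for a homogeneous right factor, and its weight changes with the
  degree of that factor. The ideal is therefore handled through products of a relation with monomials.\<close>

inductive_set monomial_span :: "('i, 'k::comm_ring_1) free_alg set \<Rightarrow> ('i, 'k) free_alg set" for R where
  zero: "0 \<in> monomial_span R"
| add: "\<lbrakk>x \<in> monomial_span R; y \<in> monomial_span R\<rbrakk> \<Longrightarrow> x + y \<in> monomial_span R"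
| monomial: "r \<in> R \<Longrightarrow> Poly_Mapping.single v k * r * Poly_Mapping.single w l \<in> monomial_span R"

lemma monomial_span_mult_left:
  assumes "x \<in> monomial_span R"
  shows "z * x \<in> monomial_span R"
proof (induction z rule: poly_mapping_additive_induct)
  case (single u m)
  from assms show ?case
    by induction (auto simp: distrib_left mult_single mult.assoc[symmetric] intro: monomial_span.intros)
qed (auto simp: distrib_right intro: monomial_span.intros)

lemma monomial_span_mult_right:
  assumes "x \<in> monomial_span R"
  shows "x * z \<in> monomial_span R"
proof (induction z rule: poly_mapping_additive_induct)
  case (single u m)
  from assms show ?case
    by induction (auto simp: distrib_right mult_single mult.assoc intro: monomial_span.intros
        monomial_span.monomial[unfolded mult.assoc])
qed (auto simp: distrib_left intro: monomial_span.intros)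

text \<open>Every element of the free algebra is a sum of monomials, so the span already absorbs
  multiplication from both sides; minimality of the generated ideal gives the inclusion.\<close>

lemma genideal_monomial_span: "Idl\<^bsub>ring_of_type_algebra\<^esub> R \<subseteq> monomial_span R"
proof (rule ring.genideal_minimal[OF ring_of_algebra])
  let ?A = "ring_of_type_algebra :: ('a, 'b) free_alg ring"
  have neg: "- x \<in> monomial_span R" if "x \<in> monomial_span R" for x
    using monomial_span_mult_left[OF that, of "- 1"] by simp
  show "ideal (monomial_span R) ?A"
  proof (rule idealI[OF ring_of_algebra])
    have inv: "inv\<^bsub>add_monoid ?A\<^esub> x = - x" for x
      using abelian_group.minus_equality[OF ring.is_abelian_group[OF ring_of_algebra], of "- x" x]
      by (simp add: a_inv_def ring_of_type_algebra_def)
    show "subgroup (monomial_span R) (add_monoid ?A)"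
    proof (rule subgroup.intro)
      show "inv\<^bsub>add_monoid ?A\<^esub> x \<in> monomial_span R" if "x \<in> monomial_span R" for x
        unfolding inv using that by (rule neg)
    qed (auto simp: ring_of_type_algebra_def intro: monomial_span.intros)
  qed (auto simp: ring_of_type_algebra_def intro: monomial_span_mult_left monomial_span_mult_right)
  show "R \<subseteq> monomial_span R"
  proof
    fix r assume "r \<in> R"
    then have "Poly_Mapping.single 0 1 * r * Poly_Mapping.single 0 1 \<in> monomial_span R"
      by (rule monomial_span.monomial)
    then show "r \<in> monomial_span R" by simp
  qed
qed


section \<open>Quantum factorials and Serre elements\<close>

text \<open>Factor $q^n - q^{-n} = -q^{-n}(1 - q^{2n})$.\<close>

lemma unit_diff_unit_inv:
  assumes "(q :: 'k::comm_ring_1) dvd 1" "\<And>n::nat. 0 < n \<Longrightarrow> (1 - q ^ n) dvd 1" "0 < n"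
  shows "(q ^ n - unit_inv q ^ n) dvd 1"
proof -
  have "unit_inv q ^ n * q ^ (2 * n) = q ^ n"
    using assms(1) by (simp add: mult_2 power_add unit_inv_left flip: mult.assoc power_mult_distrib)
  then have "q ^ n - unit_inv q ^ n = - (unit_inv q ^ n * (1 - q ^ (2 * n)))"
    by (simp add: algebra_simps)
  moreover have "unit_inv q ^ n dvd 1"
    using unit_inv_unit[OF assms(1)] by (metis dvd_power_same power_one)
  moreover have "(1 - q ^ (2 * n)) dvd 1" using assms by simp
  ultimately show ?thesis by (simp add: unit_mult)
qed

lemma quantum_factorial_unit:
  assumes "(q :: 'k::comm_ring_1) dvd 1" "\<And>n::nat. 0 < n \<Longrightarrow> (1 - q ^ n) dvd 1"
  shows "quantum_factorial q n dvd 1"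
proof (induction n)
  case (Suc n)
  have "(q - unit_inv q) dvd 1"
    using unit_diff_unit_inv[OF assms, of 1] by simp
  then show ?case
    using Suc unit_diff_unit_inv[OF assms, of "Suc n"]
    by (auto simp: quantum_factorial_def prod.nat_ivl_Suc' intro!: unit_mult unit_inv_unit)
qed (simp add: quantum_factorial_def)

text \<open>For $s^2 = 1$ this is $s^{n(n-1)/2}$. Replacing q by s q multiplies the k-th quantum
  integer by $s^k$ from its numerator and by one more s from its denominator.\<close>

definition sign_factorial :: "'k::comm_ring_1 \<Rightarrow> nat \<Rightarrow> 'k" where
  "sign_factorial s n = (\<Prod>k = 1..n. s ^ (k + 1))"

lemma sign_factorial_Suc: "sign_factorial s (Suc n) = sign_factorial s n * s ^ (n + 2)"
  by (simp add: sign_factorial_def prod.nat_ivl_Suc' ac_simps)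

lemma sign_even_power: "(s :: 'k::comm_ring_1)\<^sup>2 = 1 \<Longrightarrow> even n \<Longrightarrow> s ^ n = 1"
  by (auto elim!: evenE simp: power_mult)

lemma sign_factorial_squared: "(s :: 'k::comm_ring_1)\<^sup>2 = 1 \<Longrightarrow> (sign_factorial s n)\<^sup>2 = 1"
  by (induction n)
    (simp_all add: sign_factorial_def prod.nat_ivl_Suc' power_mult_distrib sign_even_power
      flip: power_mult)

lemma sign_factorial_add:
  assumes "(s :: 'k::comm_ring_1)\<^sup>2 = 1"
  shows "sign_factorial s m * sign_factorial s k * s ^ ((m + k - 1) * k) = sign_factorial s (m + k)"
proof -
  have *: "sign_factorial s m * sign_factorial s k * s ^ (m * k) = sign_factorial s (m + k)"
  proof (induction k)
    case (Suc k)
    have "sign_factorial s m * sign_factorial s (Suc k) * s ^ (m * Suc k)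
        = (sign_factorial s m * sign_factorial s k * s ^ (m * k)) * (s ^ (k + 2) * s ^ m)"
      by (simp only: sign_factorial_Suc mult_Suc_right power_add ac_simps)
    also have "\<dots> = sign_factorial s (m + Suc k)"
      unfolding Suc.IH by (simp only: sign_factorial_Suc add_Suc_right power_add ac_simps)
    finally show ?case .
  qed (simp add: sign_factorial_def)
  have "(m + k - 1) * k = m * k + k * (k - 1)" by (cases k) (auto simp: algebra_simps)
  moreover have "even (k * (k - 1))" by (cases k) auto
  ultimately show ?thesis using * sign_even_power[OF assms] by (simp add: power_add)
qed

lemma quantum_factorial_sign:
  assumes "(q :: 'k::comm_ring_1) dvd 1" "\<And>n::nat. 0 < n \<Longrightarrow> (1 - q ^ n) dvd 1" "s\<^sup>2 = 1"
  shows "quantum_factorial (s * q) n = sign_factorial s n * quantum_factorial q n"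
proof -
  have inv: "unit_inv (s * q) = s * unit_inv q"
    using assms by (simp add: unit_inv_mult sign_unit unit_inv_sign)
  have "(q - unit_inv q) dvd 1" using unit_diff_unit_inv[OF assms(1,2), of 1] by simp
  then have "unit_inv (s * (q - unit_inv q)) = s * unit_inv (q - unit_inv q)"
    using assms by (simp add: unit_inv_mult sign_unit unit_inv_sign)
  then have den: "unit_inv (s * q - s * unit_inv q) = s * unit_inv (q - unit_inv q)"
    by (simp add: right_diff_distrib)
  show ?thesis
    unfolding quantum_factorial_def sign_factorial_def inv den prod.distrib[symmetric]
    by (rule prod.cong) (simp_all add: power_mult_distrib algebra_simps)
qed

lemma gen_power: "gen g ^ n = Poly_Mapping.single (Word (replicate n g)) 1"
  by (induction n) (simp_all add: gen_def mult_single plus_word_def flip: zero_word_def)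

text \<open>Each summand is a single monomial, so a twisted Serre element can be compared with the
  original one coefficient by coefficient.\<close>

lemma serre_gen:
  "serre q N t (gen g) (gen g') =
    (\<Sum>k = 0..N. Poly_Mapping.single (Word (replicate (N - k) g @ g' # replicate k g))
      (t ^ k * (unit_inv (quantum_factorial q (N - k)) * unit_inv (quantum_factorial q k))))"
  unfolding serre_def divided_power_def gen_power
  by (rule sum.cong) (simp_all add: gen_def scal_def mult_single plus_word_def zero_word_def ac_simps)

lemma word_degree_append:
  "word_degree \<alpha> (Word (gs @ hs)) = word_degree \<alpha> (Word gs) + word_degree \<alpha> (Word hs)"
  by (simp add: word_degree_def)

lemma homogeneous_serre: "\<exists>\<beta>. homogeneous \<alpha> \<beta> (serre q N t (gen g) (gen g'))"
proof
  have "word_degree \<alpha> (Word (replicate (N - k) g @ g' # replicate k g))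
      = word_degree \<alpha> (Word (replicate N g)) + gen_degree \<alpha> g'" if "k \<le> N" for k
  proof -
    have "word_degree \<alpha> (Word (replicate (N - k) g @ replicate k g)) = word_degree \<alpha> (Word (replicate N g))"
      using that by (simp flip: replicate_add)
    then show ?thesis by (simp add: word_degree_append word_degree_Cons ac_simps)
  qed
  then show "homogeneous \<alpha> (word_degree \<alpha> (Word (replicate N g)) + gen_degree \<alpha> g')
      (serre q N t (gen g) (gen g'))"
    unfolding serre_gen by (intro homogeneous_sum) (simp add: homogeneous_def)
qed

text \<open>In the word $g^{N-k} g' g^k$ the letters left of $g'$ are shifted by its degree, which
  gives $b^{N-k}$, and $g'$ is shifted by k letters, which gives $b'^k$. Together with the factor
  $r^k$ from the coefficient this is $b^N$, independent of k. By \<open>sign_factorial_add\<close>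
  the sign $s^{N-1}$ removes the dependence on k that the quantum factorials introduce. All terms
  therefore acquire the same scalar.\<close>

lemma twist_serre:
  fixes c :: "'i qgen \<Rightarrow> 'p::ab_group_add \<Rightarrow> 'k::comm_ring_1"
  assumes G: "\<And>\<nu>. \<nu> \<in> G \<Longrightarrow> \<nu> + gen_degree \<alpha> g \<in> G"
    and g: "\<And>\<nu>. \<nu> \<in> G \<Longrightarrow> c g (\<nu> + gen_degree \<alpha> g') = b * c g \<nu>"
    and g': "\<And>\<nu>. \<nu> \<in> G \<Longrightarrow> c g' (\<nu> + gen_degree \<alpha> g) = b' * c g' \<nu>"
    and b: "b' * r = b"
    and q: "q dvd 1" "\<And>n::nat. 0 < n \<Longrightarrow> (1 - q ^ n) dvd 1"
    and s: "s\<^sup>2 = 1"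
    and \<mu>: "\<mu> \<in> G"
  shows "\<exists>k. twist \<alpha> c \<mu> (serre (s * q) N (t * r * s ^ (N - 1)) (gen g) (gen g'))
    = scal k * serre q N t (gen g) (gen g')"
proof -
  have deg: "\<nu> + word_degree \<alpha> (Word (replicate n g)) \<in> G" if "\<nu> \<in> G" for \<nu> n
  proof (induction n)
    case (Suc n)
    from G[OF this] show ?case by (simp add: word_degree_Cons ac_simps)
  qed (use that in simp)
  have rep: "word_twist \<alpha> c (\<nu> + gen_degree \<alpha> g') (Word (replicate n g))
      = b ^ n * word_twist \<alpha> c \<nu> (Word (replicate n g))" if "\<nu> \<in> G" for \<nu> n
  proof (induction n)
    case (Suc n)
    then show ?case using g[OF deg[OF that, of n]] by (simp add: word_twist_Cons ac_simps)
  qed simp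
  have mid: "c g' (\<nu> + word_degree \<alpha> (Word (replicate n g))) = b' ^ n * c g' \<nu>" if "\<nu> \<in> G" for \<nu> n
  proof (induction n)
    case (Suc n)
    then show ?case using g'[OF deg[OF that, of n]]
      by (simp add: word_degree_Cons ac_simps)
  qed simp
  define w where "w k = Word (replicate (N - k) g @ g' # replicate k g)" for k
  have tw: "word_twist \<alpha> c \<mu> (w k)
      = b ^ (N - k) * b' ^ k * c g' \<mu> * word_twist \<alpha> c \<mu> (Word (replicate N g))" if "k \<le> N" for k
  proof -
    have "w k = Word (replicate (N - k) g) + (Word [g'] + Word (replicate k g))"
      by (simp add: w_def plus_word_def)
    then have "word_twist \<alpha> c \<mu> (w k)
        = word_twist \<alpha> c (\<mu> + word_degree \<alpha> (Word (replicate k g)) + gen_degree \<alpha> g') (Word (replicate (N - k) g))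
          * (c g' (\<mu> + word_degree \<alpha> (Word (replicate k g))) * word_twist \<alpha> c \<mu> (Word (replicate k g)))"
      by (simp add: word_twist_add word_twist_Cons word_degree_Cons ac_simps)
    also have "\<dots> = b ^ (N - k) * b' ^ k * c g' \<mu>
        * (word_twist \<alpha> c (\<mu> + word_degree \<alpha> (Word (replicate k g))) (Word (replicate (N - k) g))
           * word_twist \<alpha> c \<mu> (Word (replicate k g)))"
      unfolding rep[OF deg[OF \<mu>]] mid[OF \<mu>] by (simp add: ac_simps)
    also have "word_twist \<alpha> c (\<mu> + word_degree \<alpha> (Word (replicate k g))) (Word (replicate (N - k) g))
           * word_twist \<alpha> c \<mu> (Word (replicate k g))
        = word_twist \<alpha> c \<mu> (Word (replicate (N - k) g) + Word (replicate k g))"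
      by (simp only: word_twist_add)
    also have "Word (replicate (N - k) g) + Word (replicate k g) = Word (replicate N g)"
      using that by (simp add: plus_word_def flip: replicate_add)
    finally show ?thesis .
  qed
  let ?C = "c g' \<mu> * word_twist \<alpha> c \<mu> (Word (replicate N g)) * b ^ N * sign_factorial s N"
  have inv: "unit_inv (quantum_factorial (s * q) n)
      = sign_factorial s n * unit_inv (quantum_factorial q n)" for n
    using s q by (simp add: quantum_factorial_sign unit_inv_mult sign_unit unit_inv_sign
        sign_factorial_squared quantum_factorial_unit)
  have coeff: "word_twist \<alpha> c \<mu> (w k) * ((t * r * s ^ (N - 1)) ^ k
      * (unit_inv (quantum_factorial (s * q) (N - k)) * unit_inv (quantum_factorial (s * q) k)))
    = ?C * (t ^ k * (unit_inv (quantum_factorial q (N - k)) * unit_inv (quantum_factorial q k)))"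
    if k: "k \<le> N" for k
  proof -
    have "b ^ N = b ^ (N - k) * (b' ^ k * r ^ k)"
      using k by (simp add: b flip: power_add power_mult_distrib)
    moreover have "sign_factorial s N = sign_factorial s (N - k) * sign_factorial s k * (s ^ (N - 1)) ^ k"
      using sign_factorial_add[OF s, of "N - k" k] k by (simp flip: power_mult)
    ultimately show ?thesis
      unfolding tw[OF k] inv by (simp add: power_mult_distrib ac_simps)
  qed
  have "twist \<alpha> c \<mu> (serre (s * q) N (t * r * s ^ (N - 1)) (gen g) (gen g'))
      = scal ?C * serre q N t (gen g) (gen g')"
    unfolding serre_gen twist_sum sum_distrib_left w_def[symmetric]
    by (rule sum.cong) (simp_all only: twist_single scal_mult_single coeff atLeastAtMost_iff)
  then show ?thesis by blast
qed


section \<open>Twisting the defining relations\<close>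

text \<open>$K_i$ and its inverse get the same factor because \<epsilon> will have square 1.\<close>

primrec letter_twist :: "('i \<Rightarrow> 'p \<Rightarrow> 'k) \<Rightarrow> ('i \<Rightarrow> 'p \<Rightarrow> 'k) \<Rightarrow> ('i \<Rightarrow> 'p \<Rightarrow> 'k) \<Rightarrow> 'i qgen \<Rightarrow> 'p \<Rightarrow> 'k" where
  "letter_twist \<epsilon> x y (Gen_e i) = x i"
| "letter_twist \<epsilon> x y (Gen_f i) = y i"
| "letter_twist \<epsilon> x y (Gen_K i) = \<epsilon> i"
| "letter_twist \<epsilon> x y (Gen_Kinv i) = \<epsilon> i"

lemma admissible_unit_diff:
  assumes "admissible_parameters a \<theta> pp p"
  shows "(p i - unit_inv (p i)) dvd 1"
  using unit_diff_unit_inv[of "p i" 1] assms by (simp add: admissible_parameters_def)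

lemma homogeneous_letter:
  "homogeneous \<alpha> 0 (gK i)" "homogeneous \<alpha> 0 (gKinv i)"
  "homogeneous \<alpha> (\<alpha> i) (ge i)" "homogeneous \<alpha> (- \<alpha> i) (gf i)"
  using homogeneous_gen[of \<alpha> "Gen_K i"] homogeneous_gen[of \<alpha> "Gen_Kinv i"]
    homogeneous_gen[of \<alpha> "Gen_e i"] homogeneous_gen[of \<alpha> "Gen_f i"] by simp_all

text \<open>Homogeneity allows a relation to be the right factor in
  \<open>twist_mult\<close>.\<close>

lemma homogeneous_U_relation:
  fixes \<alpha> :: "'i \<Rightarrow> 'p::ab_group_add" and r :: "('i, 'k::comm_ring_1) free_alg"
  assumes "r \<in> U_relations a \<theta> pp p"
  shows "\<exists>\<beta>. homogeneous \<alpha> \<beta> r"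
proof -
  note K = homogeneous_letter(1)[of \<alpha>]
  note Kinv = homogeneous_letter(2)[of \<alpha>]
  note e = homogeneous_letter(3)[of \<alpha>]
  note f = homogeneous_letter(4)[of \<alpha>]
  have one: "homogeneous \<alpha> 0 (1 :: ('i, 'k) free_alg)"
    using homogeneous_scal[of \<alpha> 1] by simp
  have KKinv: "homogeneous \<alpha> 0 (gK i * gKinv i - 1 :: ('i, 'k) free_alg)" "homogeneous \<alpha> 0 (gKinv i * gK i - 1 :: ('i, 'k) free_alg)"
    and KK: "homogeneous \<alpha> 0 (gK i * gK j - gK j * gK i :: ('i, 'k) free_alg)" for i j
    by (rule homogeneous_diff homogeneous_mult[OF K Kinv, simplified]
        homogeneous_mult[OF Kinv K, simplified] homogeneous_mult[OF K K, simplified] one)+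
  have Ke: "homogeneous \<alpha> (\<alpha> j) (gK i * ge j * gKinv i - scal k * ge j)"
    and Kf: "homogeneous \<alpha> (- \<alpha> j) (gK i * gf j * gKinv i - scal k * gf j)" for i j and k :: 'k
    by (rule homogeneous_diff homogeneous_mult[OF homogeneous_mult[OF K e] Kinv, simplified]
        homogeneous_mult[OF homogeneous_mult[OF K f] Kinv, simplified]
        homogeneous_mult[OF homogeneous_scal e, simplified]
        homogeneous_mult[OF homogeneous_scal f, simplified])+
  have ef: "homogeneous \<alpha> (\<alpha> i - \<alpha> j) (ge i * gf j - scal k * gf j * ge i
      - (if i = j then scal l * (gK i - gKinv i) else 0))" for i j and k l :: 'k
  proof -
    have "homogeneous \<alpha> (\<alpha> i - \<alpha> j) (ge i * gf j - scal k * gf j * ge i)"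
      by (rule homogeneous_diff homogeneous_mult[OF e f, simplified]
          homogeneous_mult[OF homogeneous_mult[OF homogeneous_scal f] e, simplified])+
    moreover have "homogeneous \<alpha> 0 (scal l * (gK i - gKinv i))"
      by (rule homogeneous_mult[OF homogeneous_scal homogeneous_diff[OF K Kinv], simplified])
    ultimately show ?thesis by (auto intro: homogeneous_diff)
  qed
  show ?thesis
    using assms unfolding U_relations_def
    by (elim UnE CollectE exE conjE; hypsubst) (rule exI KKinv KK Ke Kf ef homogeneous_serre)+
qed

text \<open>Here \<open>\<sigma>\<close>, \<open>\<tau>\<close>, \<open>\<eta>\<close> and \<open>\<epsilon>\<close> are the ratios of the primed to the unprimed
  parameters $p_{ij}$, $\theta_{ij}$, $p_i$ and $\chi_i$. The action of $e_i$ and $f_i$ on the weight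
  space of weight \<open>\<mu>\<close> is to be rescaled by \<open>x i \<mu>\<close> and \<open>y i \<mu>\<close>.\<close>

locale twisting =
  fixes a :: "'i \<Rightarrow> 'i \<Rightarrow> int" and \<alpha> :: "'i \<Rightarrow> 'p::ab_group_add" and G :: "'p set"
    and \<theta> \<theta>' pp pp' :: "'i \<Rightarrow> 'i \<Rightarrow> 'k::comm_ring_1" and p p' :: "'i \<Rightarrow> 'k"
    and \<sigma> \<tau> A :: "'i \<Rightarrow> 'i \<Rightarrow> 'k" and \<eta> :: "'i \<Rightarrow> 'k" and \<epsilon> x y :: "'i \<Rightarrow> 'p \<Rightarrow> 'k"
  assumes nonpos: "i \<noteq> j \<Longrightarrow> a i j \<le> 0"
    and G_closed: "\<lbrakk>\<mu> \<in> G; \<beta> \<in> root_lattice \<alpha>\<rbrakk> \<Longrightarrow> \<mu> + \<beta> \<in> G"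
    and params: "admissible_parameters a \<theta> pp p"
    and params': "admissible_parameters a \<theta>' pp' p'"
    and pp': "pp' i j = \<sigma> i j * pp i j" and \<sigma>: "(\<sigma> i j)\<^sup>2 = 1"
    and \<theta>': "\<theta>' i j = \<tau> i j * \<theta> i j" and \<tau>: "\<tau> i j dvd 1"
    and p': "p' i = \<eta> i * p i" and \<eta>: "(\<eta> i)\<^sup>2 = 1"
    and \<epsilon>: "\<mu> \<in> G \<Longrightarrow> (\<epsilon> i \<mu>)\<^sup>2 = 1"
    and \<epsilon>_shift: "\<mu> \<in> G \<Longrightarrow> \<epsilon> i (\<mu> + \<alpha> j) = \<sigma> i j * \<epsilon> i \<mu>"
    and \<sigma>\<tau>: "\<sigma> i j * \<sigma> j i = \<tau> i j * \<tau> j i"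
    and A: "A i j dvd 1" and A\<tau>: "A i j * \<tau> j i = \<sigma> j i * A j i"
    and x: "\<mu> \<in> G \<Longrightarrow> x i \<mu> dvd 1"
    and x_shift: "\<mu> \<in> G \<Longrightarrow> x i (\<mu> + \<alpha> j) = A i j * x i \<mu>"
    and xy: "\<mu> \<in> G \<Longrightarrow> y i (\<mu> + \<alpha> i) * x i \<mu> = \<epsilon> i (\<mu> + \<alpha> i) * \<eta> i"
begin

abbreviation "c \<equiv> letter_twist \<epsilon> x y"

lemma G_add: "\<mu> \<in> G \<Longrightarrow> \<mu> + \<alpha> i \<in> G"
  using G_closed[of \<mu> "\<alpha> i"] by (simp add: root_lattice_def zmod.span_base)

lemma G_diff: "\<mu> \<in> G \<Longrightarrow> \<mu> - \<alpha> i \<in> G"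
  using G_closed[of \<mu> "- \<alpha> i"] by (simp add: root_lattice_def zmod.span_neg zmod.span_base)

lemma G_gen: "\<mu> \<in> G \<Longrightarrow> \<mu> + gen_degree \<alpha> g \<in> G"
  by (cases g) (use G_add G_diff in auto)

lemma G_word: "\<mu> \<in> G \<Longrightarrow> \<mu> + word_degree \<alpha> w \<in> G"
proof (cases w)
  case (Word gs)
  assume "\<mu> \<in> G"
  then have "\<mu> + word_degree \<alpha> (Word gs) \<in> G"
  proof (induction gs)
    case (Cons g gs)
    then show ?case using G_gen[of "\<mu> + word_degree \<alpha> (Word gs)" g]
      by (simp add: word_degree_Cons ac_simps)
  qed simp
  with Word show ?thesis by simp
qed

text \<open>The condition \<open>xy\<close> determines \<open>y\<close> by \<open>x\<close> and
  \<open>\<epsilon>\<close>, so its behaviour under shifts follows from theirs.\<close>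

lemma y_shift:
  assumes "\<mu> \<in> G"
  shows "y i (\<mu> - \<alpha> j) = \<sigma> i j * A i j * y i \<mu>"
proof (rule unit_left_cancel)
  \<comment> \<open>The lowest of the weights involved: all others are reached from it by adding
    simple roots, the direction in which \<open>xy\<close>, \<open>x_shift\<close> and
    \<open>\<epsilon>_shift\<close> are stated.\<close>
  let ?\<nu> = "\<mu> - \<alpha> i - \<alpha> j"
  have G: "?\<nu> \<in> G" "\<mu> - \<alpha> i \<in> G" "\<mu> - \<alpha> j \<in> G" using assms by (simp_all add: G_diff)
  show "x i ?\<nu> dvd 1" using G by (rule_tac x)
  have 1: "y i (\<mu> - \<alpha> j) * x i ?\<nu> = \<epsilon> i (\<mu> - \<alpha> j) * \<eta> i"
    using xy[OF G(1), of i] by (simp add: algebra_simps)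
  have 2: "y i \<mu> * x i (\<mu> - \<alpha> i) = \<epsilon> i \<mu> * \<eta> i"
    using xy[OF G(2), of i] by (simp add: algebra_simps)
  have 3: "x i (\<mu> - \<alpha> i) = A i j * x i ?\<nu>"
    using x_shift[OF G(1), of i j] by (simp add: algebra_simps)
  have 4: "\<epsilon> i \<mu> = \<sigma> i j * \<epsilon> i (\<mu> - \<alpha> j)"
    using \<epsilon>_shift[OF G(3), of i j] by (simp add: algebra_simps)
  have "x i ?\<nu> * (\<sigma> i j * A i j * y i \<mu>) = \<sigma> i j * (y i \<mu> * x i (\<mu> - \<alpha> i))"
    by (simp add: 3 ac_simps)
  also have "\<dots> = (\<sigma> i j)\<^sup>2 * (\<epsilon> i (\<mu> - \<alpha> j) * \<eta> i)"
    by (simp add: 2 4 power2_eq_square ac_simps)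
  finally show "x i ?\<nu> * y i (\<mu> - \<alpha> j) = x i ?\<nu> * (\<sigma> i j * A i j * y i \<mu>)"
    using 1 by (simp add: \<sigma> ac_simps)
qed

lemma sign_cancel: "(s :: 'k)\<^sup>2 = 1 \<Longrightarrow> s * (s * k) = k"
  by (simp add: power2_eq_square flip: mult.assoc)

lemma twist_K_relation:
  assumes "\<mu> \<in> G"
  shows "twist \<alpha> c \<mu> (gK i * gKinv i - 1) = gK i * gKinv i - 1"
    and "twist \<alpha> c \<mu> (gKinv i * gK i - 1) = gKinv i * gK i - 1"
    and "twist \<alpha> c \<mu> (gK i * gK j - gK j * gK i) = scal (\<epsilon> i \<mu> * \<epsilon> j \<mu>) * (gK i * gK j - gK j * gK i)"
proof -
  have s: "\<epsilon> i \<mu> * \<epsilon> i \<mu> = 1"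
    using \<epsilon>[OF assms, of i] by (simp add: power2_eq_square)
  show "twist \<alpha> c \<mu> (gK i * gKinv i - 1) = gK i * gKinv i - 1"
    "twist \<alpha> c \<mu> (gKinv i * gK i - 1) = gKinv i * gK i - 1"
    using s by (simp_all add: twist_diff twist_mult_gen twist_gen flip: mult.assoc scal_mult)
  show "twist \<alpha> c \<mu> (gK i * gK j - gK j * gK i) = scal (\<epsilon> i \<mu> * \<epsilon> j \<mu>) * (gK i * gK j - gK j * gK i)"
    by (simp add: twist_diff twist_mult_gen twist_gen right_diff_distrib flip: mult.assoc scal_mult)
      (simp add: mult.commute)
qed

lemma twist_Ke_relation:
  assumes "\<mu> \<in> G"
  shows "twist \<alpha> c \<mu> (gK i * ge j * gKinv i - scal (pp' i j) * ge j)
    = scal (\<sigma> i j * x j \<mu>) * (gK i * ge j * gKinv i - scal (pp i j) * ge j)"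
proof -
  have 1: "\<epsilon> i \<mu> * (x j \<mu> * \<epsilon> i (\<mu> + \<alpha> j)) = \<sigma> i j * x j \<mu>"
    unfolding \<epsilon>_shift[OF assms]
    by (rule trans[OF _ sign_cancel[OF \<epsilon>[OF assms]]]) (simp only: ac_simps)
  have "twist \<alpha> c \<mu> (gK i * ge j * gKinv i) = scal (\<epsilon> i \<mu> * (x j \<mu> * \<epsilon> i (\<mu> + \<alpha> j))) * (gK i * ge j * gKinv i)"
    by (simp add: twist_mult_gen twist_gen) (simp add: scal_mult mult.assoc)
  moreover have "twist \<alpha> c \<mu> (scal (pp' i j) * ge j) = scal (\<sigma> i j * x j \<mu>) * (scal (pp i j) * ge j)"
    by (simp add: twist_scal_mult twist_gen pp' flip: mult.assoc scal_mult) (simp only: ac_simps)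
  ultimately show ?thesis by (simp add: twist_diff right_diff_distrib 1)
qed

lemma twist_Kf_relation:
  assumes "\<mu> \<in> G"
  shows "twist \<alpha> c \<mu> (gK i * gf j * gKinv i - scal (unit_inv (pp' i j)) * gf j)
    = scal (\<sigma> i j * y j \<mu>) * (gK i * gf j * gKinv i - scal (unit_inv (pp i j)) * gf j)"
proof -
  have "\<epsilon> i \<mu> = \<sigma> i j * \<epsilon> i (\<mu> - \<alpha> j)"
    using \<epsilon>_shift[OF G_diff[OF assms, of j], of i j] by simp
  then have "\<epsilon> i \<mu> * (y j \<mu> * \<epsilon> i (\<mu> - \<alpha> j))
      = \<epsilon> i (\<mu> - \<alpha> j) * (\<epsilon> i (\<mu> - \<alpha> j) * (\<sigma> i j * y j \<mu>))"
    by (simp only: ac_simps)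
  also have "\<dots> = \<sigma> i j * y j \<mu>"
    by (rule sign_cancel[OF \<epsilon>[OF G_diff[OF assms]]])
  finally have 1: "\<epsilon> i \<mu> * (y j \<mu> * \<epsilon> i (\<mu> - \<alpha> j)) = \<sigma> i j * y j \<mu>" .
  have inv: "unit_inv (pp' i j) = \<sigma> i j * unit_inv (pp i j)"
    using params by (simp add: pp' unit_inv_mult sign_unit unit_inv_sign \<sigma> admissible_parameters_def)
  have "twist \<alpha> c \<mu> (gK i * gf j * gKinv i) = scal (\<epsilon> i \<mu> * (y j \<mu> * \<epsilon> i (\<mu> - \<alpha> j))) * (gK i * gf j * gKinv i)"
    by (simp add: twist_mult_gen twist_gen) (simp add: scal_mult mult.assoc)
  moreover have "twist \<alpha> c \<mu> (scal (unit_inv (pp' i j)) * gf j)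
      = scal (\<sigma> i j * y j \<mu>) * (scal (unit_inv (pp i j)) * gf j)"
    by (simp add: twist_scal_mult twist_gen inv flip: mult.assoc scal_mult) (simp only: ac_simps)
  ultimately show ?thesis by (simp add: twist_diff right_diff_distrib 1)
qed

lemma twist_ef_relation:
  assumes "\<mu> \<in> G"
  shows "twist \<alpha> c \<mu> (ge i * gf j - scal (\<theta>' j i) * gf j * ge i
        - (if i = j then scal (unit_inv (p' i - unit_inv (p' i))) * (gK i - gKinv i) else 0))
    = scal (y j \<mu> * x i (\<mu> - \<alpha> j)) * (ge i * gf j - scal (\<theta> j i) * gf j * ge i
        - (if i = j then scal (unit_inv (p i - unit_inv (p i))) * (gK i - gKinv i) else 0))"
proof -
  let ?s = "y j \<mu> * x i (\<mu> - \<alpha> j)"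
  let ?Y = "y j (\<mu> + \<alpha> i)"
  have ef: "twist \<alpha> c \<mu> (ge i * gf j) = scal ?s * (ge i * gf j)"
    by (simp add: twist_mult_gen twist_gen) (simp add: scal_mult mult.assoc)
  have xA: "x i \<mu> = A i j * x i (\<mu> - \<alpha> j)"
    using x_shift[OF G_diff[OF assms, of j], of i j] by simp
  have yA: "y j \<mu> = \<sigma> j i * A j i * ?Y"
    using y_shift[OF G_add[OF assms, of i], of j i] by simp
  have "\<theta>' j i * (x i \<mu> * ?Y) = (A i j * \<tau> j i) * (\<theta> j i * x i (\<mu> - \<alpha> j) * ?Y)"
    unfolding \<theta>' xA by (simp only: ac_simps)
  also have "\<dots> = ?s * \<theta> j i"
    unfolding A\<tau> yA by (simp only: ac_simps)
  finally have *: "\<theta>' j i * (x i \<mu> * ?Y) = ?s * \<theta> j i" .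
  have "twist \<alpha> c \<mu> (scal (\<theta>' j i) * gf j * ge i)
      = scal (\<theta>' j i * (x i \<mu> * ?Y)) * (gf j * ge i)"
    by (simp add: mult.assoc twist_scal_mult) (simp add: twist_mult_gen twist_gen scal_mult mult.assoc)
  then have fe: "twist \<alpha> c \<mu> (scal (\<theta>' j i) * gf j * ge i) = scal ?s * (scal (\<theta> j i) * gf j * ge i)"
    unfolding * by (simp only: scal_mult mult.assoc)
  have KK: "twist \<alpha> c \<mu> (scal (unit_inv (p' i - unit_inv (p' i))) * (gK i - gKinv i))
      = scal ?s * (scal (unit_inv (p i - unit_inv (p i))) * (gK i - gKinv i))" if "i = j"
  proof -
    have "unit_inv (p' i) = \<eta> i * unit_inv (p i)"
      using params by (simp add: p' unit_inv_mult sign_unit unit_inv_sign \<eta> admissible_parameters_def)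
    then have "p' i - unit_inv (p' i) = \<eta> i * (p i - unit_inv (p i))"
      by (simp add: p' right_diff_distrib)
    then have 1: "unit_inv (p' i - unit_inv (p' i)) = \<eta> i * unit_inv (p i - unit_inv (p i))"
      using admissible_unit_diff[OF params, of i] by (simp add: unit_inv_mult sign_unit unit_inv_sign \<eta>)
    have 2: "?s = \<epsilon> i \<mu> * \<eta> i"
      using xy[OF G_diff[OF assms, of i], of i] that by simp
    have "twist \<alpha> c \<mu> (gK i - gKinv i) = scal (\<epsilon> i \<mu>) * (gK i - gKinv i)"
      by (simp add: twist_diff twist_gen right_diff_distrib)
    moreover have "\<eta> i * unit_inv (p i - unit_inv (p i)) * \<epsilon> i \<mu>
        = \<epsilon> i \<mu> * \<eta> i * unit_inv (p i - unit_inv (p i))"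
      by (simp only: ac_simps)
    ultimately show ?thesis
      unfolding 1 2 twist_scal_mult by (simp only: scal_mult[symmetric] mult.assoc[symmetric])
  qed
  show ?thesis using ef fe KK by (cases "i = j") (simp_all add: twist_diff right_diff_distrib)
qed

lemma serre_coeff_ratio:
  assumes "i \<noteq> j"
  shows "serre_coeff a pp' p' i j = serre_coeff a pp p i j * \<sigma> i j * \<eta> i ^ (nat (1 - a i j) - 1)"
proof -
  have "nat (1 - a i j) - 1 = nat (- a i j)" using nonpos[OF assms] by linarith
  then show ?thesis
    using nonpos[OF assms] by (simp add: serre_coeff_def unit_powi_def pp' p' power_mult_distrib ac_simps)
qed

lemma twist_serre_e:
  assumes "\<mu> \<in> G" "i \<noteq> j"
  shows "\<exists>k. twist \<alpha> c \<mu> (serre (p' i) (nat (1 - a i j)) (- serre_coeff a pp' p' i j * \<theta>' i j) (ge i) (ge j))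
    = scal k * serre (p i) (nat (1 - a i j)) (- serre_coeff a pp p i j * \<theta> i j) (ge i) (ge j)"
proof -
  let ?N = "nat (1 - a i j)"
  have t: "- serre_coeff a pp' p' i j * \<theta>' i j
      = (- serre_coeff a pp p i j * \<theta> i j) * (\<sigma> i j * \<tau> i j) * \<eta> i ^ (?N - 1)"
    by (simp add: serre_coeff_ratio[OF assms(2)] \<theta>' ac_simps)
  \<comment> \<open>The remaining ratio of the coefficients has to serve as \<open>r\<close> in
    \<open>twist_serre\<close>, that is, to carry \<open>A j i\<close> to \<open>A i j\<close>. This
    is \<open>A\<tau>\<close> with i and j exchanged, where \<open>\<sigma> i j\<close> is its own
    inverse.\<close>
  have "A j i * (\<sigma> i j * \<tau> i j) = \<sigma> i j * (A j i * \<tau> i j)" by (simp add: ac_simps)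
  also have "\<dots> = A i j" by (simp add: A\<tau> sign_cancel \<sigma>)
  finally have b: "A j i * (\<sigma> i j * \<tau> i j) = A i j" .
  show ?thesis
    unfolding t p'
    by (rule twist_serre[where G = G and b = "A i j" and b' = "A j i", OF _ _ _ b])
      (use params in \<open>simp_all add: G_add x_shift \<eta> assms admissible_parameters_def\<close>)
qed

lemma twist_serre_f:
  assumes "\<mu> \<in> G" "i \<noteq> j"
  shows "\<exists>k. twist \<alpha> c \<mu> (serre (p' i) (nat (1 - a i j)) (- serre_coeff a pp' p' i j * unit_inv (\<theta>' j i)) (gf i) (gf j))
    = scal k * serre (p i) (nat (1 - a i j)) (- serre_coeff a pp p i j * unit_inv (\<theta> j i)) (gf i) (gf j)"
proof -
  let ?N = "nat (1 - a i j)"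
  have "unit_inv (\<theta>' j i) = unit_inv (\<tau> j i) * unit_inv (\<theta> j i)"
    using params \<tau> by (simp add: \<theta>' unit_inv_mult admissible_parameters_def)
  then have t: "- serre_coeff a pp' p' i j * unit_inv (\<theta>' j i)
      = (- serre_coeff a pp p i j * unit_inv (\<theta> j i)) * (\<sigma> i j * unit_inv (\<tau> j i)) * \<eta> i ^ (?N - 1)"
    by (simp add: serre_coeff_ratio[OF assms(2)] ac_simps)
  \<comment> \<open>The letters $f_i$ lower the weight, so the shift factors are those of
    \<open>y_shift\<close>; their extra signs turn the required identity into \<open>A\<tau>\<close>
    without an exchange of indices.\<close>
  have "\<sigma> j i * A j i * (\<sigma> i j * unit_inv (\<tau> j i)) = \<sigma> i j * (A i j * \<tau> j i) * unit_inv (\<tau> j i)"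
    by (simp add: A\<tau> ac_simps)
  also have "\<dots> = \<sigma> i j * A i j" by (simp add: mult.assoc unit_inv_right \<tau>)
  finally have b: "\<sigma> j i * A j i * (\<sigma> i j * unit_inv (\<tau> j i)) = \<sigma> i j * A i j" .
  show ?thesis
    unfolding t p'
    by (rule twist_serre[where G = G and b = "\<sigma> i j * A i j" and b' = "\<sigma> j i * A j i", OF _ _ _ b])
      (use params in \<open>simp_all add: G_diff y_shift \<eta> assms admissible_parameters_def\<close>)
qed

lemma twist_relation:
  assumes "r \<in> U_relations a \<theta>' pp' p'" "\<mu> \<in> G"
  shows "twist \<alpha> c \<mu> r \<in> U_ideal a \<theta> pp p"
  using assms(1) unfolding U_relations_def
proof (elim UnE CollectE exE conjE)
  note rels = U_ideal_mult_left[OF U_ideal_relations(1)] U_ideal_relations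
    U_ideal_mult_left[OF U_ideal_relations(3)] U_ideal_mult_left[OF U_ideal_relations(4)]
    U_ideal_mult_left[OF U_ideal_relations(5)] U_ideal_mult_left[OF U_ideal_relations(6)]
  fix i j
  show ?thesis if "r = gK i * gKinv i - 1"
    unfolding that twist_K_relation[OF assms(2)] by (rule rels)
  show ?thesis if "r = gKinv i * gK i - 1"
    unfolding that twist_K_relation[OF assms(2)] by (rule rels)
  show ?thesis if "r = gK i * gK j - gK j * gK i"
    unfolding that twist_K_relation[OF assms(2)] by (rule rels)
  show ?thesis if "r = gK i * ge j * gKinv i - scal (pp' i j) * ge j"
    unfolding that twist_Ke_relation[OF assms(2)] by (rule rels)
  show ?thesis if "r = gK i * gf j * gKinv i - scal (unit_inv (pp' i j)) * gf j"
    unfolding that twist_Kf_relation[OF assms(2)] by (rule rels)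
  show ?thesis if "r = ge i * gf j - scal (\<theta>' j i) * gf j * ge i
      - (if i = j then scal (unit_inv (p' i - unit_inv (p' i))) * (gK i - gKinv i) else 0)"
    unfolding that twist_ef_relation[OF assms(2)] by (rule rels)
  show ?thesis if "r = serre (p' i) (nat (1 - a i j)) (- serre_coeff a pp' p' i j * unit_inv (\<theta>' j i)) (gf i) (gf j)" "i \<noteq> j"
    using twist_serre_f[OF assms(2) that(2)] U_ideal_mult_left[OF U_ideal_relations(7)[OF that(2)]]
    unfolding that(1) by metis
  show ?thesis if "r = serre (p' i) (nat (1 - a i j)) (- serre_coeff a pp' p' i j * \<theta>' i j) (ge i) (ge j)" "i \<noteq> j"
    using twist_serre_e[OF assms(2) that(2)] U_ideal_mult_left[OF U_ideal_relations(8)[OF that(2)]]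
    unfolding that(1) by metis
qed

text \<open>Inside a product $v r w$ the relation r acts at the weight \<mu> plus the degree of w.
  This weight lies in \<open>G\<close> again, which is why \<open>twist_relation\<close> is stated
  for all weights of \<open>G\<close>. The twisted monomials around r are absorbed by the
  ideal.\<close>

lemma twist_U_ideal:
  assumes "z \<in> U_ideal a \<theta>' pp' p'" "\<mu> \<in> G"
  shows "twist \<alpha> c \<mu> z \<in> U_ideal a \<theta> pp p"
proof -
  have "z \<in> monomial_span (U_relations a \<theta>' pp' p')"
    using assms(1) genideal_monomial_span unfolding U_ideal_def by blast
  then show ?thesis
  proof induction
    case (monomial r v k w l)
    obtain \<beta> where "homogeneous \<alpha> \<beta> r" using homogeneous_U_relation[OF monomial] by blast
    then show ?case
      using twist_relation[OF monomial G_word[OF assms(2), of w]]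
      by (simp only: twist_mult[OF homogeneous_single] twist_mult
          U_ideal_mult_left U_ideal_mult_right)
  qed (simp_all add: twist_add U_ideal_zero U_ideal_add)
qed

end


section \<open>Existence of the rescaling\<close>

lemma unit_powi_zero [simp]: "unit_powi x 0 = 1"
  by (simp add: unit_powi_def)

lemma unit_powi_Suc:
  assumes "(x :: 'k::comm_ring_1) dvd 1"
  shows "unit_powi x (n + 1) = x * unit_powi x n"
proof (cases "0 \<le> n")
  case True
  then have "nat (n + 1) = Suc (nat n)" by simp
  with True show ?thesis by (simp add: unit_powi_def)
next
  case False
  then have "nat (- n) = Suc (nat (- (n + 1)))" by simp
  with False assms show ?thesis
    by (auto simp: unit_powi_def unit_inv_right simp flip: mult.assoc)
qed

lemma unit_powi_unit: "(x :: 'k::comm_ring_1) dvd 1 \<Longrightarrow> unit_powi x n dvd 1"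
  by (simp add: unit_powi_def) (metis dvd_power_same power_one unit_inv_unit)

text \<open>For independent roots and invertible \<open>b i\<close> this is, on the root lattice,
  the homomorphism into the units that sends \<open>\<alpha> i\<close> to \<open>b i\<close>,
  written in coordinates with respect to the simple roots.\<close>

definition root_character :: "('i \<Rightarrow> 'p::ab_group_add) \<Rightarrow> ('i \<Rightarrow> 'k::comm_ring_1) \<Rightarrow> 'p \<Rightarrow> 'k" where
  "root_character \<alpha> b \<beta> = (\<Prod>v | zmod.representation (range \<alpha>) \<beta> v \<noteq> 0.
     unit_powi (b (inv_into UNIV \<alpha> v)) (zmod.representation (range \<alpha>) \<beta> v))"

lemma root_character_unit: "(\<And>i. b i dvd 1) \<Longrightarrow> root_character \<alpha> b \<beta> dvd 1"
  unfolding root_character_def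
  by (rule prod_dvd_prod[where g = "\<lambda>_. 1", simplified]) (simp add: unit_powi_unit)

lemma root_character_add:
  fixes \<alpha> :: "'i \<Rightarrow> 'p::ab_group_add" and b :: "'i \<Rightarrow> 'k::comm_ring_1"
  assumes \<alpha>: "inj \<alpha>" "zmod.independent (range \<alpha>)" and b: "\<And>i. b i dvd 1"
    and \<beta>: "\<beta> \<in> root_lattice \<alpha>"
  shows "root_character \<alpha> b (\<beta> + \<alpha> j) = b j * root_character \<alpha> b \<beta>"
proof -
  let ?R = "zmod.representation (range \<alpha>)"
  have mem: "\<beta> \<in> zmod.span (range \<alpha>)" "\<alpha> j \<in> zmod.span (range \<alpha>)"
    using \<beta> by (simp_all add: root_lattice_def zmod.span_base)
  have R: "?R (\<beta> + \<alpha> j) v = ?R \<beta> v + (if v = \<alpha> j then 1 else 0)" for v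
    using zmod.representation_diff[OF \<alpha>(2) mem(2) zmod.span_add[OF mem]]
      zmod.representation_basis[OF \<alpha>(2), of "\<alpha> j"] by (simp add: fun_eq_iff split: if_splits)
  \<comment> \<open>A common index set for both products: the root \<open>\<alpha> j\<close> may be
    missing from the support of \<beta>, or drop out of the support after the shift.\<close>
  define S where "S = insert (\<alpha> j) {v. ?R \<beta> v \<noteq> 0}"
  have S: "finite S" "\<alpha> j \<in> S" by (simp_all add: S_def zmod.finite_representation)
  have "root_character \<alpha> b \<beta> = (\<Prod>v\<in>S. unit_powi (b (inv_into UNIV \<alpha> v)) (?R \<beta> v))"
    unfolding root_character_def by (rule prod.mono_neutral_left[OF S(1)]) (auto simp: S_def)
  also have "\<dots> = unit_powi (b j) (?R \<beta> (\<alpha> j))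
      * (\<Prod>v\<in>S - {\<alpha> j}. unit_powi (b (inv_into UNIV \<alpha> v)) (?R \<beta> v))"
    by (subst prod.remove[OF S]) (simp add: \<alpha>(1))
  finally have 1: "root_character \<alpha> b \<beta> = \<dots>" .
  have "root_character \<alpha> b (\<beta> + \<alpha> j) = (\<Prod>v\<in>S. unit_powi (b (inv_into UNIV \<alpha> v)) (?R (\<beta> + \<alpha> j) v))"
    unfolding root_character_def
    by (rule prod.mono_neutral_left[OF S(1)]) (auto simp: S_def R split: if_splits)
  also have "\<dots> = unit_powi (b j) (?R \<beta> (\<alpha> j) + 1)
      * (\<Prod>v\<in>S - {\<alpha> j}. unit_powi (b (inv_into UNIV \<alpha> v)) (?R (\<beta> + \<alpha> j) v))"
    by (subst prod.remove[OF S]) (simp add: \<alpha>(1) R)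
  also have "(\<Prod>v\<in>S - {\<alpha> j}. unit_powi (b (inv_into UNIV \<alpha> v)) (?R (\<beta> + \<alpha> j) v))
      = (\<Prod>v\<in>S - {\<alpha> j}. unit_powi (b (inv_into UNIV \<alpha> v)) (?R \<beta> v))"
    by (rule prod.cong) (auto simp: R)
  finally show ?thesis by (simp add: 1 unit_powi_Suc b mult.assoc)
qed

text \<open>A homomorphism on the root lattice may fail to extend to the weight lattice. Only the
  behaviour under shifts by roots matters, so a base point is chosen in each coset of the root
  lattice and the character is evaluated on the difference.\<close>

definition coset_character :: "('i \<Rightarrow> 'p::ab_group_add) \<Rightarrow> ('i \<Rightarrow> 'k::comm_ring_1) \<Rightarrow> 'p \<Rightarrow> 'k" where
  "coset_character \<alpha> b \<mu> = root_character \<alpha> b (\<mu> - (SOME \<nu>. \<mu> - \<nu> \<in> root_lattice \<alpha>))"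

lemma coset_character_unit: "(\<And>i. b i dvd 1) \<Longrightarrow> coset_character \<alpha> b \<mu> dvd 1"
  unfolding coset_character_def by (rule root_character_unit)

lemma coset_character_add:
  fixes \<alpha> :: "'i \<Rightarrow> 'p::ab_group_add" and b :: "'i \<Rightarrow> 'k::comm_ring_1"
  assumes \<alpha>: "inj \<alpha>" "zmod.independent (range \<alpha>)" and b: "\<And>i. b i dvd 1"
  shows "coset_character \<alpha> b (\<mu> + \<alpha> j) = b j * coset_character \<alpha> b \<mu>"
proof -
  define \<nu> where "\<nu> = (SOME \<nu>. \<mu> - \<nu> \<in> root_lattice \<alpha>)"
  have "\<mu> - \<mu> \<in> root_lattice \<alpha>" by (simp add: root_lattice_def zmod.span_zero)
  then have \<nu>: "\<mu> - \<nu> \<in> root_lattice \<alpha>" unfolding \<nu>_def by (rule someI)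
  \<comment> \<open>The predicates under \<open>SOME\<close> coincide for \<open>\<mu>\<close> and
    \<open>\<mu> + \<alpha> j\<close>, so both weights get the same base point.\<close>
  have "\<mu> + \<alpha> j - \<rho> \<in> root_lattice \<alpha> \<longleftrightarrow> \<mu> - \<rho> \<in> root_lattice \<alpha>" for \<rho>
    using zmod.span_add_eq2[of "\<alpha> j" "range \<alpha>" "\<mu> - \<rho>"]
    by (simp add: root_lattice_def zmod.span_base algebra_simps)
  then have "(SOME \<nu>. \<mu> + \<alpha> j - \<nu> \<in> root_lattice \<alpha>) = \<nu>" by (simp add: \<nu>_def)
  then have "coset_character \<alpha> b (\<mu> + \<alpha> j) = root_character \<alpha> b (\<mu> - \<nu> + \<alpha> j)"
    by (simp add: coset_character_def algebra_simps)
  then show ?thesis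
    using root_character_add[OF \<alpha>, of b "\<mu> - \<nu>" j] b \<nu>
    by (simp add: coset_character_def \<nu>_def)
qed

lemma unit_ratio_sign:
  assumes "(u :: 'k::comm_ring_1)\<^sup>2 = v\<^sup>2" "v dvd 1"
  shows "(u * unit_inv v)\<^sup>2 = 1"
  unfolding power_mult_distrib assms(1)
  by (simp add: unit_inv_right[OF assms(2)] flip: power_mult_distrib)

lemma unit_ratio: "(v :: 'k::comm_ring_1) dvd 1 \<Longrightarrow> u = u * unit_inv v * v"
  by (simp add: mult.assoc unit_inv_left)

lemma unit_ratio_unit: "\<lbrakk>(u :: 'k::comm_ring_1) dvd 1; v dvd 1\<rbrakk> \<Longrightarrow> u * unit_inv v dvd 1"
  by (simp add: unit_mult unit_inv_unit)

text \<open>Orients every pair of indices: \<open>A i j\<close> below carries the whole ratio for one orientation and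
  is \<open>1\<close> for the other.\<close>

lemma ex_tournament: "\<exists>lt :: 'i \<Rightarrow> 'i \<Rightarrow> bool. \<forall>i j. i \<noteq> j \<longrightarrow> lt i j \<longleftrightarrow> \<not> lt j i"
proof -
  \<comment> \<open>A well-order serves as a total order on an arbitrary index type.\<close>
  obtain r :: "'i rel" where "well_order_on UNIV r" using well_order_on by blast
  then have "total_on UNIV r" "antisym r"
    by (simp_all add: well_order_on_def linear_order_on_def partial_order_on_def)
  then have "\<forall>i j. i \<noteq> j \<longrightarrow> (i, j) \<in> r \<longleftrightarrow> (j, i) \<notin> r"
    unfolding total_on_def antisym_def by blast
  then show ?thesis by (intro exI[of _ "\<lambda>i j. (i, j) \<in> r"])
qed

text \<open>The ratios \<sigma>, \<eta> and \<epsilon> have square 1 and are their own inverses;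
  \<tau>, \<open>A\<close> and \<open>x\<close> are inverted. The last function is what
  \<open>xy\<close> dictates for the inverted \<open>x\<close>; that it is inverse to
  \<open>y\<close> as well is part of \<open>letter_twist_inverse\<close>.\<close>

lemma (in twisting) twisting_inverse:
  "twisting a \<alpha> G \<theta>' \<theta> pp' pp p' p \<sigma> (\<lambda>i j. unit_inv (\<tau> i j)) (\<lambda>i j. unit_inv (A i j)) \<eta> \<epsilon>
     (\<lambda>i \<mu>. unit_inv (x i \<mu>)) (\<lambda>i \<mu>. \<epsilon> i \<mu> * \<eta> i * x i (\<mu> - \<alpha> i))"
proof unfold_locales
  fix i j \<mu>
  show "pp i j = \<sigma> i j * pp' i j" by (simp add: pp' sign_cancel \<sigma>)
  show "p i = \<eta> i * p' i" by (simp add: p' sign_cancel \<eta>)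
  show "\<theta> i j = unit_inv (\<tau> i j) * \<theta>' i j"
    by (simp add: \<theta>' unit_inv_left \<tau> flip: mult.assoc)
  show "\<sigma> i j * \<sigma> j i = unit_inv (\<tau> i j) * unit_inv (\<tau> j i)"
    using arg_cong[OF \<sigma>\<tau>, of unit_inv i j]
    by (simp add: unit_inv_mult \<tau> sign_unit unit_inv_sign \<sigma>)
  show "unit_inv (A i j) * unit_inv (\<tau> j i) = \<sigma> j i * unit_inv (A j i)"
    using arg_cong[OF A\<tau>, of unit_inv i j]
    by (simp add: unit_inv_mult \<tau> A sign_unit unit_inv_sign \<sigma>)
  show "unit_inv (x i (\<mu> + \<alpha> j)) = unit_inv (A i j) * unit_inv (x i \<mu>)" if "\<mu> \<in> G"
    by (simp add: x_shift that unit_inv_mult A x)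
  show "\<epsilon> i (\<mu> + \<alpha> i) * \<eta> i * x i (\<mu> + \<alpha> i - \<alpha> i) * unit_inv (x i \<mu>) = \<epsilon> i (\<mu> + \<alpha> i) * \<eta> i" if "\<mu> \<in> G"
    by (simp add: mult.assoc unit_inv_right x that)
qed (use nonpos G_closed params params' \<sigma> \<tau> \<eta> \<epsilon> \<epsilon>_shift A x in \<open>auto intro: unit_inv_unit\<close>)

lemma (in twisting) letter_twist_inverse:
  assumes "\<mu> \<in> G"
  shows "letter_twist \<epsilon> x y g \<mu> * letter_twist \<epsilon> (\<lambda>i \<mu>. unit_inv (x i \<mu>))
    (\<lambda>i \<mu>. \<epsilon> i \<mu> * \<eta> i * x i (\<mu> - \<alpha> i)) g \<mu> = 1"
proof (cases g)
  case (Gen_f i)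
  have "y i \<mu> * x i (\<mu> - \<alpha> i) = \<epsilon> i \<mu> * \<eta> i"
    using xy[OF G_diff[OF assms], of i i] by simp
  then have "y i \<mu> * (\<epsilon> i \<mu> * \<eta> i * x i (\<mu> - \<alpha> i)) = (\<epsilon> i \<mu>)\<^sup>2 * (\<eta> i)\<^sup>2"
    by (simp add: power2_eq_square mult.left_commute mult.commute) (simp add: ac_simps)
  with Gen_f show ?thesis by (simp add: \<epsilon> \<eta> assms)
qed (use \<epsilon>[OF assms] x[OF assms] in \<open>simp_all add: unit_inv_right power2_eq_square\<close>)

lemma ex_twisting:
  fixes a :: "'i \<Rightarrow> 'i \<Rightarrow> int" and \<alpha> :: "'i \<Rightarrow> 'p::ab_group_add"
    and \<theta> \<theta>' pp pp' :: "'i \<Rightarrow> 'i \<Rightarrow> 'k::comm_ring_1"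
  assumes cartan: "cartan_datum a \<alpha> h"
    and G: "\<And>\<mu> \<beta>. \<mu> \<in> G \<Longrightarrow> \<beta> \<in> root_lattice \<alpha> \<Longrightarrow> \<mu> + \<beta> \<in> G"
    and params: "admissible_parameters a \<theta> pp p" and params': "admissible_parameters a \<theta>' pp' p'"
    and p2: "\<And>i. (p i)\<^sup>2 = (p' i)\<^sup>2"
    and \<chi>: "weight_characters \<alpha> h G pp p \<chi>" and \<chi>': "weight_characters \<alpha> h G pp' p' \<chi>'"
  obtains \<sigma> \<tau> A \<eta> \<epsilon> x y where "twisting a \<alpha> G \<theta> \<theta>' pp pp' p p' \<sigma> \<tau> A \<eta> \<epsilon> x y"
    and "\<And>i \<mu>. \<mu> \<in> G \<Longrightarrow> \<chi>' i \<mu> = \<epsilon> i \<mu> * \<chi> i \<mu>"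
proof -
  have units: "\<theta> i j dvd 1" "pp i j dvd 1" "p i dvd 1" "\<theta>' i j dvd 1" "pp' i j dvd 1" "p' i dvd 1" for i j
    using params params' by (simp_all add: admissible_parameters_def)
  have units\<chi>: "\<chi> i \<mu> dvd 1" "\<chi>' i \<mu> dvd 1" if "\<mu> \<in> G" for i \<mu>
    using \<chi> \<chi>' that by (simp_all add: weight_characters_def)
  have powi: "unit_powi (p' i) (2 * n) = unit_powi (p i) (2 * n)" for i n
    by (simp add: unit_powi_double units p2)
  define \<sigma> where "\<sigma> i j = pp' i j * unit_inv (pp i j)" for i j
  define \<tau> where "\<tau> i j = \<theta>' i j * unit_inv (\<theta> i j)" for i j
  define \<eta> where "\<eta> i = p' i * unit_inv (p i)" for i
  define \<epsilon> where "\<epsilon> i \<mu> = \<chi>' i \<mu> * unit_inv (\<chi> i \<mu>)" for i \<mu>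
  obtain lt :: "'i \<Rightarrow> 'i \<Rightarrow> bool" where lt: "\<And>i j. i \<noteq> j \<Longrightarrow> lt i j \<longleftrightarrow> \<not> lt j i"
    using ex_tournament by metis
  define A where "A i j = (if lt i j then \<sigma> j i * unit_inv (\<tau> j i) else 1)" for i j
  define x where "x i = coset_character \<alpha> (A i)" for i
  \<comment> \<open>The condition \<open>xy\<close> at the weight \<open>\<mu> - \<alpha> i\<close>,
    solved for \<open>y\<close>.\<close>
  define y where "y i \<mu> = \<epsilon> i \<mu> * \<eta> i * unit_inv (x i (\<mu> - \<alpha> i))" for i \<mu>
  have pp'_eq: "pp' i j = \<sigma> i j * pp i j" and \<theta>'_eq: "\<theta>' i j = \<tau> i j * \<theta> i j" for i j
    unfolding \<sigma>_def \<tau>_def by (intro unit_ratio units)+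
  have \<chi>'_eq: "\<chi>' i \<mu> = \<epsilon> i \<mu> * \<chi> i \<mu>" if "\<mu> \<in> G" for i \<mu>
    unfolding \<epsilon>_def by (intro unit_ratio units\<chi> that)
  have \<tau>: "\<tau> i j dvd 1" for i j
    unfolding \<tau>_def by (intro unit_ratio_unit units)
  have \<sigma>: "(\<sigma> i j)\<^sup>2 = 1" for i j
    unfolding \<sigma>_def using params params' powi
    by (intro unit_ratio_sign units) (simp add: admissible_parameters_def)
  have A: "A i j dvd 1" for i j
    by (simp add: A_def unit_ratio_unit sign_unit \<sigma> \<tau>)
  have \<alpha>: "inj \<alpha>" "zmod.independent (range \<alpha>)"
    using cartan by (simp_all add: cartan_datum_def)
  have x: "x i \<mu> dvd 1" for i \<mu>
    unfolding x_def by (rule coset_character_unit[OF A])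
  have prod_eq: "pp i j * pp j i = unit_powi (p i) (2 * a i j) * (\<theta> i j * \<theta> j i)"
    "pp' i j * pp' j i = unit_powi (p i) (2 * a i j) * (\<theta>' i j * \<theta>' j i)" for i j
  proof -
    have "pp i j * pp j i * unit_inv (\<theta> i j * \<theta> j i) = unit_powi (p i) (2 * a i j)"
      "pp' i j * pp' j i * unit_inv (\<theta>' i j * \<theta>' j i) = unit_powi (p i) (2 * a i j)"
      using params params' powi[of i "a i j"] by (simp_all add: admissible_parameters_def)
    then show "pp i j * pp j i = unit_powi (p i) (2 * a i j) * (\<theta> i j * \<theta> j i)"
      "pp' i j * pp' j i = unit_powi (p i) (2 * a i j) * (\<theta>' i j * \<theta>' j i)"
      by (metis unit_ratio unit_mult units)+
  qed
  have \<sigma>\<tau>: "\<sigma> i j * \<sigma> j i = \<tau> i j * \<tau> j i" for i j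
  proof (rule unit_left_cancel)
    show "pp i j * pp j i dvd 1" by (intro unit_mult units)
    have "pp i j * pp j i * (\<sigma> i j * \<sigma> j i) = pp' i j * pp' j i"
      unfolding pp'_eq by (simp only: ac_simps)
    also have "\<dots> = unit_powi (p i) (2 * a i j) * (\<theta> i j * \<theta> j i) * (\<tau> i j * \<tau> j i)"
      unfolding prod_eq \<theta>'_eq by (simp only: ac_simps)
    finally show "pp i j * pp j i * (\<sigma> i j * \<sigma> j i) = pp i j * pp j i * (\<tau> i j * \<tau> j i)"
      by (simp only: prod_eq)
  qed
  have \<sigma>\<tau>_diag: "\<sigma> i i = \<tau> i i" for i
  proof (rule unit_left_cancel)
    show "pp i i dvd 1" by (rule units)
    have "pp i i * unit_inv (\<theta> i i) = (p i)\<^sup>2" "pp' i i * unit_inv (\<theta>' i i) = (p i)\<^sup>2"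
      using params params' by (simp_all add: admissible_parameters_def p2)
    then have *: "pp i i = (p i)\<^sup>2 * \<theta> i i" "pp' i i = (p i)\<^sup>2 * \<theta>' i i"
      by (metis unit_ratio units)+
    have "pp i i * \<sigma> i i = pp' i i" by (simp add: pp'_eq ac_simps)
    also have "\<dots> = pp i i * \<tau> i i" unfolding * \<theta>'_eq by (simp only: ac_simps)
    finally show "pp i i * \<sigma> i i = pp i i * \<tau> i i" .
  qed
  have A\<tau>: "A i j * \<tau> j i = \<sigma> j i * A j i" for i j
  proof (cases "i = j")
    case True
    then show ?thesis by (simp add: \<sigma>\<tau>_diag ac_simps)
  next
    case False
    \<comment> \<open>For the other orientation of the pair: here \<open>A i j\<close> is 1 and
      \<open>A j i\<close> carries the ratio with exchanged indices. By
      \<open>\<sigma>\<tau>\<close> the two ratios are inverse to each other, so the orientation is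
      immaterial.\<close>
    have 1: "\<tau> j i = \<sigma> j i * (\<sigma> i j * unit_inv (\<tau> i j))"
      using \<sigma>\<tau>[of j i] by (simp add: mult.assoc unit_inv_right \<tau> flip: mult.assoc[of "\<sigma> j i"])
    have 2: "\<sigma> j i * unit_inv (\<tau> j i) * \<tau> j i = \<sigma> j i"
      by (simp add: mult.assoc unit_inv_left \<tau>)
    show ?thesis
    proof (cases "lt i j")
      case True
      with lt[OF False] 2 show ?thesis by (simp add: A_def)
    next
      case F: False
      with lt[OF False] have "lt j i" by blast
      with F 1 show ?thesis by (simp add: A_def)
    qed
  qed
  have "twisting a \<alpha> G \<theta> \<theta>' pp pp' p p' \<sigma> \<tau> A \<eta> \<epsilon> x y"
  proof unfold_locales
    fix i j \<mu>
    show "a i j \<le> 0" if "i \<noteq> j"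
      using cartan that by (simp add: cartan_datum_def symmetrizable_cartan_matrix_def)
    show "p' i = \<eta> i * p i" unfolding \<eta>_def by (intro unit_ratio units)
    show "(\<eta> i)\<^sup>2 = 1" unfolding \<eta>_def by (intro unit_ratio_sign units) (simp add: p2)
    show "x i (\<mu> + \<alpha> j) = A i j * x i \<mu>"
      unfolding x_def by (rule coset_character_add[OF \<alpha> A])
    assume \<mu>: "\<mu> \<in> G"
    show "(\<epsilon> i \<mu>)\<^sup>2 = 1"
      unfolding \<epsilon>_def using \<chi> \<chi>' powi \<mu>
      by (intro unit_ratio_sign units\<chi>) (simp_all add: weight_characters_def)
    show "\<epsilon> i (\<mu> + \<alpha> j) = \<sigma> i j * \<epsilon> i \<mu>"
    proof -
      have "\<chi> i (\<mu> + \<alpha> j) = pp i j * \<chi> i \<mu>" "\<chi>' i (\<mu> + \<alpha> j) = pp' i j * \<chi>' i \<mu>"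
        using \<chi> \<chi>' \<mu> by (simp_all add: weight_characters_def)
      then show ?thesis
        by (simp add: \<epsilon>_def \<sigma>_def unit_inv_mult units units\<chi> \<mu> ac_simps)
    qed
    show "y i (\<mu> + \<alpha> i) * x i \<mu> = \<epsilon> i (\<mu> + \<alpha> i) * \<eta> i"
      by (simp add: y_def mult.assoc unit_inv_left x)
  qed (use G params params' pp'_eq \<theta>'_eq \<sigma> \<tau> \<sigma>\<tau> A A\<tau> x in auto)
  then show thesis using that \<chi>'_eq by blast
qed


section \<open>The quotient map onto $U$\<close>

lemma U_class_eq_image: "U_class a \<theta> pp p x = (\<lambda>i. i + x) ` U_ideal a \<theta> pp p"
  by (auto simp: U_class_def a_r_coset_def' ring_of_type_algebra_def)

lemma U_ideal_uminus: "x \<in> U_ideal a \<theta> pp p \<Longrightarrow> - x \<in> U_ideal a \<theta> pp p"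
  using U_ideal_mult_left[of x a \<theta> pp p "- 1"] by simp

lemma U_class_eq_iff: "U_class a \<theta> pp p x = U_class a \<theta> pp p y \<longleftrightarrow> x - y \<in> U_ideal a \<theta> pp p"
proof
  assume "U_class a \<theta> pp p x = U_class a \<theta> pp p y"
  moreover have "x \<in> U_class a \<theta> pp p x"
    using U_ideal_zero by (force simp: U_class_eq_image)
  ultimately have "x \<in> U_class a \<theta> pp p y" by simp
  then show "x - y \<in> U_ideal a \<theta> pp p" by (auto simp: U_class_eq_image)
next
  have sub: "U_class a \<theta> pp p x \<subseteq> U_class a \<theta> pp p y" if "x - y \<in> U_ideal a \<theta> pp p" for x y
  proof
    fix z assume "z \<in> U_class a \<theta> pp p x"
    then obtain i where "i \<in> U_ideal a \<theta> pp p" "z = i + x" by (auto simp: U_class_eq_image)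
    then have "z = (i + (x - y)) + y" "i + (x - y) \<in> U_ideal a \<theta> pp p"
      using that U_ideal_add by auto
    then show "z \<in> U_class a \<theta> pp p y" unfolding U_class_eq_image by (rule image_eqI)
  qed
  assume "x - y \<in> U_ideal a \<theta> pp p"
  with U_ideal_uminus[OF this] show "U_class a \<theta> pp p x = U_class a \<theta> pp p y"
    by (intro equalityI sub) simp_all
qed

lemma ring_U_alg: "ring (U_alg a \<theta> pp p)"
  unfolding U_alg_def by (rule ideal.quotient_is_ring[OF ideal_U_ideal])

lemma carrier_U_alg: "carrier (U_alg a \<theta> pp p) = range (U_class a \<theta> pp p)"
  by (auto simp: U_alg_def FactRing_def A_RCOSETS_def' U_class_def ring_of_type_algebra_def)

lemma U_class_hom: "U_class a \<theta> pp p \<in> ring_hom ring_of_type_algebra (U_alg a \<theta> pp p)"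
  using ideal.rcos_ring_hom[OF ideal_U_ideal[of a \<theta> pp p]]
  by (simp add: U_alg_def U_class_def[abs_def])

lemma U_class_add: "U_class a \<theta> pp p (x + y) = U_class a \<theta> pp p x \<oplus>\<^bsub>U_alg a \<theta> pp p\<^esub> U_class a \<theta> pp p y"
  and U_class_mult: "U_class a \<theta> pp p (x * y) = U_class a \<theta> pp p x \<otimes>\<^bsub>U_alg a \<theta> pp p\<^esub> U_class a \<theta> pp p y"
  and U_class_one: "U_class a \<theta> pp p 1 = \<one>\<^bsub>U_alg a \<theta> pp p\<^esub>"
  using ring_hom_add[OF U_class_hom, of x y a \<theta> pp p] ring_hom_mult[OF U_class_hom, of x y a \<theta> pp p]
    ring_hom_one[OF U_class_hom, of a \<theta> pp p]
  by (simp_all add: ring_of_type_algebra_def)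


section \<open>Direct sums\<close>

locale direct_sum = abelian_group M for M (structure) +
  fixes G :: "'p set" and V
  assumes direct: "internal_direct_sum M G V"

definition weight_part :: "('m, 'd) ring_scheme \<Rightarrow> 'p set \<Rightarrow> ('p \<Rightarrow> 'm set) \<Rightarrow> 'm \<Rightarrow> 'p \<Rightarrow> 'm" where
  "weight_part M G V v = (THE x. x \<in> (\<Pi>\<^sub>E \<mu>\<in>G. V \<mu>) \<and> finite {\<mu>\<in>G. x \<mu> \<noteq> \<zero>\<^bsub>M\<^esub>} \<and>
     v = finsum M x {\<mu>\<in>G. x \<mu> \<noteq> \<zero>\<^bsub>M\<^esub>})"

definition graded_map :: "('m, 'd) ring_scheme \<Rightarrow> 'p set \<Rightarrow> ('p \<Rightarrow> 'm set) \<Rightarrow> ('p \<Rightarrow> 'm \<Rightarrow> 'm) \<Rightarrow> 'm \<Rightarrow> 'm" where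
  "graded_map M G V g v =
     finsum M (\<lambda>\<mu>. g \<mu> (weight_part M G V v \<mu>)) {\<mu>\<in>G. weight_part M G V v \<mu> \<noteq> \<zero>\<^bsub>M\<^esub>}"

context direct_sum
begin

abbreviation "part \<equiv> weight_part M G V"

lemma V_subgroup: "\<mu> \<in> G \<Longrightarrow> additive_subgroup (V \<mu>) M"
  using direct by (simp add: internal_direct_sum_def)

lemma V_closed: "\<lbrakk>\<mu> \<in> G; v \<in> V \<mu>\<rbrakk> \<Longrightarrow> v \<in> carrier M"
  using additive_subgroup.a_subset[OF V_subgroup] by blast

lemma V_zero: "\<mu> \<in> G \<Longrightarrow> \<zero> \<in> V \<mu>"
  using additive_subgroup.zero_closed[OF V_subgroup] .

lemma V_add: "\<lbrakk>\<mu> \<in> G; v \<in> V \<mu>; w \<in> V \<mu>\<rbrakk> \<Longrightarrow> v \<oplus> w \<in> V \<mu>"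
  using additive_subgroup.a_closed[OF V_subgroup] .

lemma
  assumes "v \<in> carrier M"
  shows part_PiE: "part v \<in> (\<Pi>\<^sub>E \<mu>\<in>G. V \<mu>)"
    and finite_part: "finite {\<mu>\<in>G. part v \<mu> \<noteq> \<zero>}"
    and finsum_part: "finsum M (part v) {\<mu>\<in>G. part v \<mu> \<noteq> \<zero>} = v"
proof -
  have "\<exists>!x. x \<in> (\<Pi>\<^sub>E \<mu>\<in>G. V \<mu>) \<and> finite {\<mu>\<in>G. x \<mu> \<noteq> \<zero>} \<and> v = finsum M x {\<mu>\<in>G. x \<mu> \<noteq> \<zero>}"
    using direct assms unfolding internal_direct_sum_def by blast
  from theI'[OF this] show "part v \<in> (\<Pi>\<^sub>E \<mu>\<in>G. V \<mu>)" "finite {\<mu>\<in>G. part v \<mu> \<noteq> \<zero>}"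
    "finsum M (part v) {\<mu>\<in>G. part v \<mu> \<noteq> \<zero>} = v"
    unfolding weight_part_def by simp_all
qed

lemma part_V: "\<lbrakk>v \<in> carrier M; \<mu> \<in> G\<rbrakk> \<Longrightarrow> part v \<mu> \<in> V \<mu>"
  using part_PiE by (meson PiE_mem)

lemma finsum_support:
  assumes "finite S" "S \<subseteq> G" "{\<mu>\<in>G. x \<mu> \<noteq> \<zero>} \<subseteq> S" "\<And>\<mu>. \<mu> \<in> G \<Longrightarrow> x \<mu> \<in> carrier M"
  shows "finsum M x {\<mu>\<in>G. x \<mu> \<noteq> \<zero>} = finsum M x S"
  by (rule add.finprod_mono_neutral_cong_left) (use assms in auto)

lemma part_eqI:
  assumes "x \<in> (\<Pi>\<^sub>E \<mu>\<in>G. V \<mu>)" "finite S" "S \<subseteq> G" "{\<mu>\<in>G. x \<mu> \<noteq> \<zero>} \<subseteq> S"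
    and "v \<in> carrier M" "v = finsum M x S"
  shows "part v = x"
proof -
  have "\<exists>!x. x \<in> (\<Pi>\<^sub>E \<mu>\<in>G. V \<mu>) \<and> finite {\<mu>\<in>G. x \<mu> \<noteq> \<zero>} \<and> v = finsum M x {\<mu>\<in>G. x \<mu> \<noteq> \<zero>}"
    using direct assms(5) unfolding internal_direct_sum_def by blast
  moreover have "finsum M x {\<mu>\<in>G. x \<mu> \<noteq> \<zero>} = finsum M x S"
    by (rule finsum_support[OF assms(2-4)]) (use assms(1) V_closed in \<open>auto simp: PiE_iff\<close>)
  ultimately show ?thesis
    unfolding weight_part_def using assms by (intro the1_equality) (auto intro: finite_subset)
qed

lemma part_homogeneous:
  assumes "\<mu> \<in> G" "v \<in> V \<mu>"
  shows "part v = (\<lambda>\<nu>\<in>G. if \<nu> = \<mu> then v else \<zero>)"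
proof (rule part_eqI[where S = "{\<mu>}"])
  show "v = finsum M (\<lambda>\<nu>\<in>G. if \<nu> = \<mu> then v else \<zero>) {\<mu>}"
    using assms V_closed by simp
qed (use assms V_closed V_zero in auto)

lemma finsum_part_superset:
  assumes "v \<in> carrier M" "finite S" "S \<subseteq> G" "{\<mu>\<in>G. part v \<mu> \<noteq> \<zero>} \<subseteq> S"
  shows "finsum M (part v) S = v"
  using finsum_support[OF assms(2-4)] finsum_part[OF assms(1)] part_V[OF assms(1)] V_closed by metis

lemma part_add:
  assumes "v \<in> carrier M" "w \<in> carrier M"
  shows "part (v \<oplus> w) = (\<lambda>\<mu>\<in>G. part v \<mu> \<oplus> part w \<mu>)"
proof (rule part_eqI[where S = "{\<mu>\<in>G. part v \<mu> \<noteq> \<zero>} \<union> {\<mu>\<in>G. part w \<mu> \<noteq> \<zero>}"])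
  let ?S = "{\<mu>\<in>G. part v \<mu> \<noteq> \<zero>} \<union> {\<mu>\<in>G. part w \<mu> \<noteq> \<zero>}"
  have S: "finite ?S" "?S \<subseteq> G" using finite_part assms by auto
  have closed: "part v \<mu> \<in> carrier M" "part w \<mu> \<in> carrier M" if "\<mu> \<in> G" for \<mu>
    using part_V V_closed assms that by blast+
  have "finsum M (\<lambda>\<mu>\<in>G. part v \<mu> \<oplus> part w \<mu>) ?S = finsum M (\<lambda>\<mu>. part v \<mu> \<oplus> part w \<mu>) ?S"
    by (rule finsum_cong') (use closed in auto)
  also have "\<dots> = finsum M (part v) ?S \<oplus> finsum M (part w) ?S"
    by (rule finsum_addf) (use closed in auto)
  also have "\<dots> = v \<oplus> w"
    by (simp only: finsum_part_superset[OF assms(1) S] finsum_part_superset[OF assms(2) S]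
        Un_upper1 Un_upper2)
  finally show "v \<oplus> w = finsum M (\<lambda>\<mu>\<in>G. part v \<mu> \<oplus> part w \<mu>) ?S" by simp
  show "(\<lambda>\<mu>\<in>G. part v \<mu> \<oplus> part w \<mu>) \<in> (\<Pi>\<^sub>E \<mu>\<in>G. V \<mu>)"
    using V_add part_V assms by auto
qed (use assms finite_part in auto)

lemma additive_zero:
  assumes "abelian_group N" "f \<in> carrier M \<rightarrow> carrier N"
    and "\<And>v w. \<lbrakk>v \<in> carrier M; w \<in> carrier M\<rbrakk> \<Longrightarrow> f (v \<oplus> w) = f v \<oplus>\<^bsub>N\<^esub> f w"
  shows "f \<zero> = \<zero>\<^bsub>N\<^esub>"
proof -
  interpret N: abelian_group N by fact
  have "f \<zero> = f \<zero> \<oplus>\<^bsub>N\<^esub> f \<zero>" using assms(3)[of \<zero> \<zero>] by simp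
  then show ?thesis using assms(2) by (metis N.add.l_cancel_one' PiE zero_closed)
qed

text \<open>The weight spaces generate the module additively. Identities for the twisted action are
  reduced in this way to a single weight space, where the action is given by one
  \<open>twist\<close>.\<close>

lemma additive_eqI:
  assumes N: "abelian_group N"
    and f: "f \<in> carrier M \<rightarrow> carrier N"
      "\<And>v w. \<lbrakk>v \<in> carrier M; w \<in> carrier M\<rbrakk> \<Longrightarrow> f (v \<oplus> w) = f v \<oplus>\<^bsub>N\<^esub> f w"
    and g: "g \<in> carrier M \<rightarrow> carrier N"
      "\<And>v w. \<lbrakk>v \<in> carrier M; w \<in> carrier M\<rbrakk> \<Longrightarrow> g (v \<oplus> w) = g v \<oplus>\<^bsub>N\<^esub> g w"
    and eq: "\<And>\<mu> v. \<lbrakk>\<mu> \<in> G; v \<in> V \<mu>\<rbrakk> \<Longrightarrow> f v = g v"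
    and v: "v \<in> carrier M"
  shows "f v = g v"
proof -
  have "f (finsum M (part v) S) = g (finsum M (part v) S)" if "finite S" "S \<subseteq> G" for S
    using that
  proof (induction S)
    case empty
    then show ?case using additive_zero[OF N f] additive_zero[OF N g] by simp
  next
    case (insert \<mu> S)
    have *: "part v \<mu> \<in> V \<mu>" "part v \<mu> \<in> carrier M" "part v \<in> S \<rightarrow> carrier M"
      using insert.prems part_V[OF v] V_closed by blast+
    then show ?case
      using insert eq[of \<mu> "part v \<mu>"] f(2) g(2) by simp
  qed
  from this[OF finite_part[OF v]] show ?thesis by (simp add: finsum_part v)
qed

lemma
  assumes g: "\<And>\<mu> v. \<lbrakk>\<mu> \<in> G; v \<in> V \<mu>\<rbrakk> \<Longrightarrow> g \<mu> v \<in> carrier M"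
    and add: "\<And>\<mu> v w. \<lbrakk>\<mu> \<in> G; v \<in> V \<mu>; w \<in> V \<mu>\<rbrakk> \<Longrightarrow> g \<mu> (v \<oplus> w) = g \<mu> v \<oplus> g \<mu> w"
  shows graded_map_closed: "v \<in> carrier M \<Longrightarrow> graded_map M G V g v \<in> carrier M"
    and graded_map_add: "\<lbrakk>v \<in> carrier M; w \<in> carrier M\<rbrakk>
      \<Longrightarrow> graded_map M G V g (v \<oplus> w) = graded_map M G V g v \<oplus> graded_map M G V g w"
    and graded_map_homogeneous: "\<lbrakk>\<mu> \<in> G; u \<in> V \<mu>\<rbrakk> \<Longrightarrow> graded_map M G V g u = g \<mu> u"
proof -
  \<comment> \<open>Padding the sum by weights with zero component must not change it; then the sums
    for \<open>v\<close>, \<open>w\<close> and \<open>v \<oplus> w\<close> can be taken over one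
    finite set.\<close>
  have zero: "g \<mu> \<zero> = \<zero>" if "\<mu> \<in> G" for \<mu>
    using add[OF that V_zero[OF that] V_zero[OF that]] g[OF that V_zero[OF that]]
    by (metis add.l_cancel_one' l_zero zero_closed)
  have super: "graded_map M G V g v = finsum M (\<lambda>\<mu>. g \<mu> (part v \<mu>)) S"
    if "v \<in> carrier M" "finite S" "S \<subseteq> G" "{\<mu>\<in>G. part v \<mu> \<noteq> \<zero>} \<subseteq> S" for v S
    unfolding graded_map_def
    by (rule add.finprod_mono_neutral_cong_left) (use that zero g part_V in auto)
  show closed: "graded_map M G V g v \<in> carrier M" if "v \<in> carrier M" for v
    unfolding graded_map_def by (rule finsum_closed) (use g part_V that in auto)
  show "graded_map M G V g (v \<oplus> w) = graded_map M G V g v \<oplus> graded_map M G V g w"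
    if v: "v \<in> carrier M" and w: "w \<in> carrier M" for v w
  proof -
    let ?S = "{\<mu>\<in>G. part v \<mu> \<noteq> \<zero>} \<union> {\<mu>\<in>G. part w \<mu> \<noteq> \<zero>}"
    have S: "finite ?S" "?S \<subseteq> G" using finite_part v w by auto
    have "graded_map M G V g (v \<oplus> w) = finsum M (\<lambda>\<mu>. g \<mu> (part (v \<oplus> w) \<mu>)) ?S"
      by (rule super[OF _ S]) (auto simp: v w part_add)
    also have "\<dots> = finsum M (\<lambda>\<mu>. g \<mu> (part v \<mu>) \<oplus> g \<mu> (part w \<mu>)) ?S"
      by (rule finsum_cong') (use v w g part_V add in \<open>auto simp: part_add\<close>)
    also have "\<dots> = finsum M (\<lambda>\<mu>. g \<mu> (part v \<mu>)) ?S \<oplus> finsum M (\<lambda>\<mu>. g \<mu> (part w \<mu>)) ?S"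
      by (rule finsum_addf) (use v w g part_V in auto)
    also have "\<dots> = graded_map M G V g v \<oplus> graded_map M G V g w"
      using super[OF v S] super[OF w S] by simp
    finally show ?thesis .
  qed
  show "graded_map M G V g u = g \<mu> u" if "\<mu> \<in> G" "u \<in> V \<mu>" for \<mu> u
  proof -
    have "graded_map M G V g u = finsum M (\<lambda>\<nu>. g \<nu> (part u \<nu>)) {\<mu>}"
      by (rule super) (use that V_closed in \<open>auto simp: part_homogeneous\<close>)
    also have "\<dots> = g \<mu> u"
      using that g by (simp add: part_homogeneous)
    finally show ?thesis .
  qed
qed

end


section \<open>Weighted modules\<close>

locale weighted_module =
  fixes G :: "'p::ab_group_add set" and \<alpha> :: "'i \<Rightarrow> 'p" and a :: "'i \<Rightarrow> 'i \<Rightarrow> int"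
    and \<theta> pp :: "'i \<Rightarrow> 'i \<Rightarrow> 'k::comm_ring_1" and p :: "'i \<Rightarrow> 'k" and \<chi> :: "'i \<Rightarrow> 'p \<Rightarrow> 'k"
    and M :: "(('i, 'k) U_elem, 'm) module" (structure) and V :: "'p \<Rightarrow> 'm set"
  assumes weighted: "is_weighted_module G \<alpha> a \<theta> pp p \<chi> (M, V)"
begin

sublocale left_module "U_alg a \<theta> pp p" M
  using weighted by (simp add: is_weighted_module_def)

sublocale direct_sum M G V
  using weighted by unfold_locales (simp add: is_weighted_module_def)

abbreviation act :: "('i, 'k) free_alg \<Rightarrow> 'm \<Rightarrow> 'm" where
  "act x v \<equiv> U_class a \<theta> pp p x \<odot> v"

lemma act_closed: "v \<in> carrier M \<Longrightarrow> act x v \<in> carrier M"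
  by (simp add: smult_closed carrier_U_alg)

lemma act_add: "v \<in> carrier M \<Longrightarrow> act (x + y) v = act x v \<oplus> act y v"
  by (simp add: smult_l_distr carrier_U_alg U_class_add)

lemma act_mult: "v \<in> carrier M \<Longrightarrow> act (x * y) v = act x (act y v)"
  by (simp add: smult_assoc carrier_U_alg U_class_mult)

lemma act_add_right: "\<lbrakk>v \<in> carrier M; w \<in> carrier M\<rbrakk> \<Longrightarrow> act x (v \<oplus> w) = act x v \<oplus> act x w"
  by (simp add: smult_r_distr carrier_U_alg)

lemma act_one: "v \<in> carrier M \<Longrightarrow> act 1 v = v"
  by (simp add: U_class_one smult_one)

lemma V_outside: "\<mu> \<notin> G \<Longrightarrow> V \<mu> = {\<zero>}"
  using weighted by (simp add: is_weighted_module_def)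

lemma act_V:
  "\<lbrakk>\<beta> \<in> root_lattice \<alpha>; \<mu> \<in> G; homogeneous \<alpha> \<beta> x; v \<in> V \<mu>\<rbrakk> \<Longrightarrow> act x v \<in> V (\<mu> + \<beta>)"
  using weighted by (auto simp: is_weighted_module_def U_component_def homogeneous_def)

lemma act_K: "\<lbrakk>\<mu> \<in> G; v \<in> V \<mu>\<rbrakk> \<Longrightarrow> act (gK i) v = act (scal (\<chi> i \<mu>)) v"
  using weighted by (simp add: is_weighted_module_def)

end

lemma word_degree_root_lattice: "word_degree \<alpha> w \<in> root_lattice \<alpha>"
proof (cases w)
  case (Word gs)
  have "gen_degree \<alpha> g \<in> root_lattice \<alpha>" for g
    by (cases g) (auto simp: root_lattice_def intro: zmod.span_base zmod.span_neg zmod.span_zero)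
  then have "word_degree \<alpha> (Word gs) \<in> root_lattice \<alpha>"
    by (induction gs) (auto simp: word_degree_Cons root_lattice_def intro: zmod.span_add zmod.span_zero)
  with Word show ?thesis by simp
qed

text \<open>Twisting is defined on the free algebra, so a class acts through a chosen
  representative; \<open>tact_homogeneous\<close> shows that the choice does not matter. The weight
  spaces stay as they are.\<close>

definition twisted_module :: "'p set \<Rightarrow> ('i \<Rightarrow> 'p::ab_group_add) \<Rightarrow> ('i \<Rightarrow> 'i \<Rightarrow> int)
    \<Rightarrow> ('i \<Rightarrow> 'i \<Rightarrow> 'k::comm_ring_1) \<Rightarrow> ('i \<Rightarrow> 'i \<Rightarrow> 'k) \<Rightarrow> ('i \<Rightarrow> 'k)
    \<Rightarrow> ('i \<Rightarrow> 'i \<Rightarrow> 'k) \<Rightarrow> ('i \<Rightarrow> 'i \<Rightarrow> 'k) \<Rightarrow> ('i \<Rightarrow> 'k) \<Rightarrow> ('i qgen \<Rightarrow> 'p \<Rightarrow> 'k)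
    \<Rightarrow> ('i, 'k, 'p, 'm) weighted_module \<Rightarrow> ('i, 'k, 'p, 'm) weighted_module" where
  "twisted_module G \<alpha> a \<theta> pp p \<theta>' pp' p' c = (\<lambda>(M, V).
     (M\<lparr>smult := \<lambda>u. graded_map M G V (\<lambda>\<mu> v. U_class a \<theta> pp p
        (twist \<alpha> c \<mu> (SOME x. U_class a \<theta>' pp' p' x = u)) \<odot>\<^bsub>M\<^esub> v)\<rparr>, V))"

lemma abelian_group_smult_update: "abelian_group (M\<lparr>smult := s\<rparr>) \<longleftrightarrow> abelian_group M"
  by (simp add: abelian_group_def abelian_monoid_def abelian_group_axioms_def)

lemma finsum_smult_update: "finsum (M\<lparr>smult := s\<rparr>) = finsum M"
  by (simp add: finsum_def fun_eq_iff)

lemma internal_direct_sum_smult_update: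
  "internal_direct_sum (M\<lparr>smult := s\<rparr>) G V \<longleftrightarrow> internal_direct_sum M G V"
  by (simp add: internal_direct_sum_def additive_subgroup_def finsum_smult_update)

locale twisted_weighted_module =
  twisting a \<alpha> G \<theta> \<theta>' pp pp' p p' \<sigma> \<tau> A \<eta> \<epsilon> x y +
  weighted_module G \<alpha> a \<theta> pp p \<chi> M V
  for a :: "'i \<Rightarrow> 'i \<Rightarrow> int" and \<alpha> :: "'i \<Rightarrow> 'p::ab_group_add" and G :: "'p set"
    and \<theta> \<theta>' pp pp' :: "'i \<Rightarrow> 'i \<Rightarrow> 'k::comm_ring_1" and p p' :: "'i \<Rightarrow> 'k"
    and \<sigma> \<tau> A :: "'i \<Rightarrow> 'i \<Rightarrow> 'k" and \<eta> :: "'i \<Rightarrow> 'k" and \<epsilon> x y :: "'i \<Rightarrow> 'p \<Rightarrow> 'k"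
    and \<chi> and M :: "(('i, 'k) U_elem, 'm) module" (structure) and V :: "'p \<Rightarrow> 'm set"
begin

abbreviation "N \<equiv> fst (twisted_module G \<alpha> a \<theta> pp p \<theta>' pp' p' c (M, V))"

abbreviation tact :: "('i, 'k) free_alg \<Rightarrow> 'm \<Rightarrow> 'm" where
  "tact z v \<equiv> U_class a \<theta>' pp' p' z \<odot>\<^bsub>N\<^esub> v"

lemma N_simps [simp]:
  "carrier N = carrier M" "add N = add M" "zero N = zero M"
  by (simp_all add: twisted_module_def)

lemma tact_eq:
  "tact z = graded_map M G V (\<lambda>\<mu>. act (twist \<alpha> c \<mu> (SOME z'. U_class a \<theta>' pp' p' z' = U_class a \<theta>' pp' p' z)))"
  by (simp add: twisted_module_def)

lemma tact_closed: "v \<in> carrier M \<Longrightarrow> tact z v \<in> carrier M"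
  unfolding tact_eq by (rule graded_map_closed) (blast intro: act_closed act_add_right V_closed)+

lemma tact_add_right:
  "\<lbrakk>v \<in> carrier M; w \<in> carrier M\<rbrakk> \<Longrightarrow> tact z (v \<oplus> w) = tact z v \<oplus> tact z w"
  unfolding tact_eq by (rule graded_map_add) (blast intro: act_closed act_add_right V_closed)+

lemma tact_homogeneous:
  assumes "\<mu> \<in> G" "v \<in> V \<mu>"
  shows "tact z v = act (twist \<alpha> c \<mu> z) v"
proof -
  define z' where "z' = (SOME z'. U_class a \<theta>' pp' p' z' = U_class a \<theta>' pp' p' z)"
  have "U_class a \<theta>' pp' p' z' = U_class a \<theta>' pp' p' z"
    unfolding z'_def by (rule someI[of _ z]) simp
  \<comment> \<open>Two representatives differ by an element of the primed ideal, and its twist at a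
    weight in \<open>G\<close> lies in the unprimed ideal, which acts by zero.\<close>
  then have "z' - z \<in> U_ideal a \<theta>' pp' p'" by (simp add: U_class_eq_iff)
  then have "U_class a \<theta> pp p (twist \<alpha> c \<mu> z') = U_class a \<theta> pp p (twist \<alpha> c \<mu> z)"
    using twist_U_ideal[OF _ assms(1)] by (simp add: U_class_eq_iff flip: twist_diff)
  moreover have "tact z v = act (twist \<alpha> c \<mu> z') v"
    unfolding tact_eq z'_def
    by (rule graded_map_homogeneous[OF _ _ assms]) (blast intro: act_closed act_add_right V_closed)+
  ultimately show ?thesis by simp
qed

lemma abelian_group_N: "abelian_group N"
  by (simp add: twisted_module_def abelian_group_smult_update M.abelian_group_axioms)

lemma tact_eqI:
  assumes f: "\<And>v. v \<in> carrier M \<Longrightarrow> f v \<in> carrier M"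
      "\<And>v w. \<lbrakk>v \<in> carrier M; w \<in> carrier M\<rbrakk> \<Longrightarrow> f (v \<oplus> w) = f v \<oplus> f w"
    and eq: "\<And>\<mu> v. \<lbrakk>\<mu> \<in> G; v \<in> V \<mu>\<rbrakk> \<Longrightarrow> act (twist \<alpha> c \<mu> z) v = f v"
    and v: "v \<in> carrier M"
  shows "tact z v = f v"
  by (rule additive_eqI[OF M.abelian_group_axioms, where f = "tact z" and g = f])
    (use assms in \<open>auto simp: tact_closed tact_add_right tact_homogeneous\<close>)

lemma tact_add:
  assumes "v \<in> carrier M"
  shows "tact (z + w) v = tact z v \<oplus> tact w v"
proof (rule tact_eqI[OF _ _ _ assms])
  show "tact z (v \<oplus> v') \<oplus> tact w (v \<oplus> v') = (tact z v \<oplus> tact w v) \<oplus> (tact z v' \<oplus> tact w v')"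
    if "v \<in> carrier M" "v' \<in> carrier M" for v v'
    using that by (simp add: tact_add_right tact_closed M.add.m_ac)
  show "act (twist \<alpha> c \<mu> (z + w)) v = tact z v \<oplus> tact w v" if "\<mu> \<in> G" "v \<in> V \<mu>" for \<mu> v
    using that by (simp add: tact_homogeneous twist_add act_add[OF V_closed])
qed (simp add: tact_closed)

lemma tact_zero: "v \<in> carrier M \<Longrightarrow> tact 0 v = \<zero>"
  using tact_add[of v 0 0] tact_closed[of v 0] by (metis M.add.l_cancel_one' add.right_neutral)

lemma tact_zero_right: "tact z \<zero> = \<zero>"
  by (rule additive_zero[OF M.abelian_group_axioms]) (auto simp: tact_closed tact_add_right)

text \<open>A monomial sends the weight space into a single weight space, so the second action is
  again one \<open>twist\<close>, at the shifted weight, and the product rule for twisting applies.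
  General factors follow by additivity.\<close>

lemma tact_mult_single:
  assumes "\<mu> \<in> G" "v \<in> V \<mu>"
  shows "act (twist \<alpha> c \<mu> (z * Poly_Mapping.single w k)) v = tact z (tact (Poly_Mapping.single w k) v)"
proof -
  let ?s = "Poly_Mapping.single w k"
  have "act (twist \<alpha> c \<mu> ?s) v \<in> V (\<mu> + word_degree \<alpha> w)"
    by (rule act_V[OF word_degree_root_lattice assms(1) homogeneous_twist[OF homogeneous_single] assms(2)])
  then have "tact z (tact ?s v) = act (twist \<alpha> c (\<mu> + word_degree \<alpha> w) z) (act (twist \<alpha> c \<mu> ?s) v)"
    by (simp only: tact_homogeneous[OF assms] tact_homogeneous[OF G_word[OF assms(1)]])
  then show ?thesis
    by (simp only: twist_mult_single act_mult[OF V_closed[OF assms]])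
qed

lemma tact_mult: "v \<in> carrier M \<Longrightarrow> tact (z * w) v = tact z (tact w v)"
proof (induction w arbitrary: v rule: poly_mapping_additive_induct)
  case zero
  then show ?case by (simp add: tact_zero tact_zero_right)
next
  case (add w w')
  then show ?case by (simp add: distrib_left tact_add tact_add_right tact_closed)
next
  case (single w k)
  show ?case
    by (rule tact_eqI[OF _ _ tact_mult_single single]) (simp_all add: tact_closed tact_add_right)
qed

lemma tact_one: "v \<in> carrier M \<Longrightarrow> tact 1 v = v"
  by (rule tact_eqI) (simp_all add: act_one[OF V_closed])

lemma left_module_N: "left_module (U_alg a \<theta>' pp' p') N"
proof (intro left_module.intro left_module_axioms.intro ring_U_alg abelian_group_N)
qed (auto simp: carrier_U_alg tact_closed tact_add_right tact_add tact_mult tact_one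
    simp flip: U_class_add U_class_mult U_class_one)

lemma weighted_N:
  assumes \<chi>': "\<And>i \<mu>. \<mu> \<in> G \<Longrightarrow> \<chi>' i \<mu> = \<epsilon> i \<mu> * \<chi> i \<mu>"
  shows "is_weighted_module G \<alpha> a \<theta>' pp' p' \<chi>' (twisted_module G \<alpha> a \<theta> pp p \<theta>' pp' p' c (M, V))"
proof -
  have "internal_direct_sum N G V"
    using direct by (simp add: twisted_module_def internal_direct_sum_smult_update)
  moreover have "u \<odot>\<^bsub>N\<^esub> v \<in> V (\<mu> + \<beta>)"
    if "\<beta> \<in> root_lattice \<alpha>" "\<mu> \<in> G" "u \<in> U_component \<alpha> a \<theta>' pp' p' \<beta>" "v \<in> V \<mu>" for \<beta> \<mu> u v
  proof -
    obtain z where "u = U_class a \<theta>' pp' p' z" "homogeneous \<alpha> \<beta> z"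
      using \<open>u \<in> _\<close> by (auto simp: U_component_def homogeneous_def)
    then show ?thesis
      using act_V[OF that(1,2) homogeneous_twist that(4)] by (simp only: tact_homogeneous[OF that(2,4)])
  qed
  moreover have "tact (gK i) v = tact (scal (\<chi>' i \<mu>)) v" if "\<mu> \<in> G" "v \<in> V \<mu>" for i \<mu> v
    unfolding tact_homogeneous[OF that] twist_gen twist_scal letter_twist.simps
      act_mult[OF V_closed[OF that]] act_K[OF that] \<chi>'[OF that(1)]
    by (simp only: act_mult[OF V_closed[OF that]] scal_mult)
  ultimately have "is_weighted_module G \<alpha> a \<theta>' pp' p' \<chi>' (N, V)"
    using left_module_N V_outside by (simp add: is_weighted_module_def)
  moreover have "(N, V) = twisted_module G \<alpha> a \<theta> pp p \<theta>' pp' p' c (M, V)"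
    by (simp add: twisted_module_def)
  ultimately show ?thesis by (simp only:)
qed

end


lemma twisted_module_simps [simp]:
  "carrier (fst (twisted_module G \<alpha> a \<theta> pp p \<theta>' pp' p' c B)) = carrier (fst B)"
  "add (fst (twisted_module G \<alpha> a \<theta> pp p \<theta>' pp' p' c B)) = add (fst B)"
  "snd (twisted_module G \<alpha> a \<theta> pp p \<theta>' pp' p' c B) = snd B"
  by (simp_all add: twisted_module_def split: prod.split)

lemma twisted_module_inverse:
  assumes 1: "twisted_weighted_module a \<alpha> G \<theta> \<theta>' pp pp' p p' \<sigma> \<tau> A \<eta> \<epsilon> x y \<chi> M V"
    and 2: "twisted_weighted_module a \<alpha> G \<theta>' \<theta> pp' pp p' p \<sigma> \<tau>' A' \<eta> \<epsilon> x' y' \<chi>' N V"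
    and N: "N = fst (twisted_module G \<alpha> a \<theta> pp p \<theta>' pp' p' (letter_twist \<epsilon> x y) (M, V))"
    and inv: "\<And>g \<mu>. \<mu> \<in> G \<Longrightarrow> letter_twist \<epsilon> x y g \<mu> * letter_twist \<epsilon> x' y' g \<mu> = 1"
    and v: "v \<in> carrier M"
  shows "U_class a \<theta> pp p z
      \<odot>\<^bsub>fst (twisted_module G \<alpha> a \<theta>' pp' p' \<theta> pp p (letter_twist \<epsilon> x' y') (N, V))\<^esub> v
    = U_class a \<theta> pp p z \<odot>\<^bsub>M\<^esub> v"
proof -
  interpret T: twisted_weighted_module a \<alpha> G \<theta> \<theta>' pp pp' p p' \<sigma> \<tau> A \<eta> \<epsilon> x y \<chi> M V by fact
  interpret T': twisted_weighted_module a \<alpha> G \<theta>' \<theta> pp' pp p' p \<sigma> \<tau>' A' \<eta> \<epsilon> x' y' \<chi>' N V by fact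
  have N_eq: "carrier N = carrier M" "add N = add M" by (simp_all add: N)
  \<comment> \<open>A word passes through the same weights in both twists, so the factors cancel
    letter by letter.\<close>
  have "word_twist \<alpha> T.c \<mu> w * word_twist \<alpha> T'.c \<mu> w = 1" if "\<mu> \<in> G" for \<mu> w
  proof (cases w)
    case (Word gs)
    have "word_twist \<alpha> T.c \<mu> (Word gs) * word_twist \<alpha> T'.c \<mu> (Word gs) = 1"
    proof (induction gs)
      case (Cons g gs)
      have "word_twist \<alpha> T.c \<mu> (Word (g # gs)) * word_twist \<alpha> T'.c \<mu> (Word (g # gs))
        = (T.c g (\<mu> + word_degree \<alpha> (Word gs)) * T'.c g (\<mu> + word_degree \<alpha> (Word gs)))
          * (word_twist \<alpha> T.c \<mu> (Word gs) * word_twist \<alpha> T'.c \<mu> (Word gs))"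
        unfolding word_twist_Cons by (simp only: ac_simps)
      also have "\<dots> = 1" by (simp only: Cons.IH inv[OF T.G_word[OF that]] mult_1)
      finally show ?case .
    qed simp
    with Word show ?thesis by simp
  qed
  \<comment> \<open>On a weight space the doubly twisted action of \<open>z\<close> is first the
    action on \<open>N\<close> of the second twist of \<open>z\<close>, and then the action on
    \<open>M\<close> of the first twist of that element; the two twists undo each other.\<close>
  then have eq: "T'.tact z v = T.act z v" if "\<mu> \<in> G" "v \<in> V \<mu>" for \<mu> v
    using that T'.tact_homogeneous[OF that] T.tact_homogeneous[OF that] by (simp add: N twist_twist)
  show ?thesis
  proof (rule T'.additive_eqI[OF T'.abelian_group_axioms, where f = "T'.tact z" and g = "T.act z"])
    show "T.act z (v \<oplus>\<^bsub>N\<^esub> w) = T.act z v \<oplus>\<^bsub>N\<^esub> T.act z w" if "v \<in> carrier N" "w \<in> carrier N" for v w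
      using that T.act_add_right by (simp add: N_eq)
    show "T.act z \<in> carrier N \<rightarrow> carrier N" using T.act_closed by (simp add: N_eq)
    show "v \<in> carrier N" using v by (simp add: N_eq)
  qed (auto simp: eq T'.tact_closed T'.tact_add_right)
qed


section \<open>Equivalence of the module categories\<close>

lemma weighted_module_hom_iff:
  "f \<in> weighted_module_hom G a \<theta> pp p A B \<longleftrightarrow>
    f \<in> carrier (fst A) \<rightarrow>\<^sub>E carrier (fst B) \<and>
    (\<forall>v\<in>carrier (fst A). \<forall>w\<in>carrier (fst A). f (v \<oplus>\<^bsub>fst A\<^esub> w) = f v \<oplus>\<^bsub>fst B\<^esub> f w) \<and>
    (\<forall>z. \<forall>v\<in>carrier (fst A). f (U_class a \<theta> pp p z \<odot>\<^bsub>fst A\<^esub> v) = U_class a \<theta> pp p z \<odot>\<^bsub>fst B\<^esub> f v) \<and>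
    (\<forall>\<mu>\<in>G. \<forall>v\<in>snd A \<mu>. f v \<in> snd B \<mu>)"
  unfolding weighted_module_hom_def left_module_hom_def carrier_U_alg by blast

lemma weighted_module_category_simps [simp]:
  "Obj (weighted_module_category G \<alpha> a \<theta> pp p \<chi>) = {A. is_weighted_module G \<alpha> a \<theta> pp p \<chi> A}"
  "Hom (weighted_module_category G \<alpha> a \<theta> pp p \<chi>) = weighted_module_hom G a \<theta> pp p"
  "Ident (weighted_module_category G \<alpha> a \<theta> pp p \<chi>) = (\<lambda>A. restrict id (carrier (fst A)))"
  "Comp (weighted_module_category G \<alpha> a \<theta> pp p \<chi>) = (\<lambda>A B Z g f. compose (carrier (fst A)) g f)"
  by (simp_all add: weighted_module_category_def)

lemma weighted_moduleI: "is_weighted_module G \<alpha> a \<theta> pp p \<chi> A \<Longrightarrow> weighted_module G \<alpha> a \<theta> pp p \<chi> (fst A) (snd A)"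
  by unfold_locales simp

text \<open>Equality of the records would be too strong: it also compares scalar products with sets
  that are not classes and with elements outside the carrier.\<close>

definition same_weighted_module ::
  "('i \<Rightarrow> 'i \<Rightarrow> int) \<Rightarrow> ('i \<Rightarrow> 'i \<Rightarrow> 'k::comm_ring_1) \<Rightarrow> ('i \<Rightarrow> 'i \<Rightarrow> 'k) \<Rightarrow> ('i \<Rightarrow> 'k)
   \<Rightarrow> ('i, 'k, 'p, 'm) weighted_module \<Rightarrow> ('i, 'k, 'p, 'm) weighted_module \<Rightarrow> bool" where
  "same_weighted_module a \<theta> pp p A B \<longleftrightarrow>
     carrier (fst A) = carrier (fst B) \<and> add (fst A) = add (fst B) \<and> snd A = snd B \<and>
     (\<forall>z. \<forall>v\<in>carrier (fst A). U_class a \<theta> pp p z \<odot>\<^bsub>fst A\<^esub> v = U_class a \<theta> pp p z \<odot>\<^bsub>fst B\<^esub> v)"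

lemma restrict_id_hom:
  assumes A: "is_weighted_module G \<alpha> a \<theta> pp p \<chi> A" and same: "same_weighted_module a \<theta> pp p A B"
  shows "restrict id (carrier (fst A)) \<in> weighted_module_hom G a \<theta> pp p A B"
proof -
  interpret A: weighted_module G \<alpha> a \<theta> pp p \<chi> "fst A" "snd A" by (rule weighted_moduleI[OF A])
  show ?thesis
    using same A.V_closed A.act_closed A.M.a_closed
    by (auto simp: weighted_module_hom_iff same_weighted_module_def)
qed

lemma compose_hom:
  assumes A: "is_weighted_module G \<alpha> a \<theta> pp p \<chi> A"
    and f: "f \<in> weighted_module_hom G a \<theta> pp p A B" and g: "g \<in> weighted_module_hom G a \<theta> pp p B Z"
  shows "compose (carrier (fst A)) g f \<in> weighted_module_hom G a \<theta> pp p A Z"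
proof -
  interpret A: weighted_module G \<alpha> a \<theta> pp p \<chi> "fst A" "snd A" by (rule weighted_moduleI[OF A])
  have "f v \<in> carrier (fst B)" if "v \<in> carrier (fst A)" for v
    using f that by (auto simp: weighted_module_hom_iff)
  moreover have "g v \<in> carrier (fst Z)" if "v \<in> carrier (fst B)" for v
    using g that by (auto simp: weighted_module_hom_iff)
  ultimately show ?thesis
    using f g A.V_closed A.act_closed A.M.a_closed
    by (auto simp: weighted_module_hom_iff compose_def)
qed

lemma category_weighted_module_category: "category (weighted_module_category G \<alpha> a \<theta> pp p \<chi>)"
proof
  fix A B f
  assume f: "f \<in> Hom (weighted_module_category G \<alpha> a \<theta> pp p \<chi>) A B"
  then have f: "f \<in> carrier (fst A) \<rightarrow>\<^sub>E carrier (fst B)" by (simp add: weighted_module_hom_iff)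
  then show "Comp (weighted_module_category G \<alpha> a \<theta> pp p \<chi>) A A B f (Ident (weighted_module_category G \<alpha> a \<theta> pp p \<chi>) A) = f"
    by (auto simp: compose_def fun_eq_iff PiE_def extensional_def)
  from f show "Comp (weighted_module_category G \<alpha> a \<theta> pp p \<chi>) A B B (Ident (weighted_module_category G \<alpha> a \<theta> pp p \<chi>) B) f = f"
    by (auto simp: compose_def fun_eq_iff PiE_def extensional_def Pi_def)
next
  fix W A B Z f g h
  assume "f \<in> Hom (weighted_module_category G \<alpha> a \<theta> pp p \<chi>) W A"
  then have "f \<in> carrier (fst W) \<rightarrow>\<^sub>E carrier (fst A)" by (simp add: weighted_module_hom_iff)
  then show "Comp (weighted_module_category G \<alpha> a \<theta> pp p \<chi>) W B Z h
        (Comp (weighted_module_category G \<alpha> a \<theta> pp p \<chi>) W A B g f)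
      = Comp (weighted_module_category G \<alpha> a \<theta> pp p \<chi>) W A Z
        (Comp (weighted_module_category G \<alpha> a \<theta> pp p \<chi>) A B Z h g) f"
    by (auto simp: compose_def fun_eq_iff PiE_def Pi_def)
qed (auto intro: compose_hom restrict_id_hom simp: same_weighted_module_def)

lemma restrict_id_iso:
  assumes A: "is_weighted_module G \<alpha> a \<theta> pp p \<chi> A" and B: "is_weighted_module G \<alpha> a \<theta> pp p \<chi> B"
    and same: "same_weighted_module a \<theta> pp p A B"
  shows "isomorphism_in (weighted_module_category G \<alpha> a \<theta> pp p \<chi>) A B (restrict id (carrier (fst A)))"
proof -
  have same': "same_weighted_module a \<theta> pp p B A" "carrier (fst A) = carrier (fst B)"
    using same by (simp_all add: same_weighted_module_def)
  have "compose S (restrict id S) (restrict id S) = restrict id S" for S :: "'m set"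
    by (auto simp: compose_def fun_eq_iff)
  then show ?thesis
    using restrict_id_hom[OF A same] restrict_id_hom[OF B same'(1)] same'(2)
    unfolding isomorphism_in_def by auto
qed

section \<open>Functors that act identically on arrows\<close>

lemma category_functor_id: "category C \<Longrightarrow> category_functor C C (\<lambda>A. A) (\<lambda>A B f. f)"
  by (simp add: category_functor_def category_functor_axioms_def)

lemma category_functor_comp:
  assumes "category_functor C D Fo (\<lambda>A B f. f)" "category_functor D E Go (\<lambda>A B f. f)"
  shows "category_functor C E (\<lambda>A. Go (Fo A)) (\<lambda>A B f. f)"
proof -
  interpret F: category_functor C D Fo "\<lambda>A B f. f" by fact
  interpret G: category_functor D E Go "\<lambda>A B f. f" by fact
  show ?thesis
  proof (intro category_functor.intro category_functor_axioms.intro F.C.category_axioms G.D.category_axioms)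
    fix A assume A: "A \<in> Obj C"
    show "Go (Fo A) \<in> Obj E" by (rule G.obj_map[OF F.obj_map[OF A]])
    show "Ident C A = Ident E (Go (Fo A))"
      by (rule trans[OF F.ident_map[OF A] G.ident_map[OF F.obj_map[OF A]]])
    fix B f assume B: "B \<in> Obj C" and f: "f \<in> Hom C A B"
    note Ff = F.hom_map[OF A B f]
    show "f \<in> Hom E (Go (Fo A)) (Go (Fo B))"
      by (rule G.hom_map[OF F.obj_map[OF A] F.obj_map[OF B] Ff])
    fix Z g assume Z: "Z \<in> Obj C" and g: "g \<in> Hom C B Z"
    show "Comp C A B Z g f = Comp E (Go (Fo A)) (Go (Fo B)) (Go (Fo Z)) g f"
      by (rule trans[OF F.comp_map[OF A B Z f g]
            G.comp_map[OF F.obj_map[OF A] F.obj_map[OF B] F.obj_map[OF Z] Ff F.hom_map[OF B Z g]]])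
  qed
qed

text \<open>The identity of the underlying set is linear in both directions between \<open>A\<close>
  and \<open>Fo A\<close>, and naturality is immediate because \<open>Fo\<close> leaves arrows
  alone. The two directions provide the unit and the counit of the equivalence.\<close>

lemma natural_isomorphism_restrict_id:
  fixes Fo :: "('i, 'k::comm_ring_1, 'p::ab_group_add, 'm) weighted_module \<Rightarrow> ('i, 'k, 'p, 'm) weighted_module"
  defines "\<iota> \<equiv> \<lambda>A :: ('i, 'k, 'p, 'm) weighted_module. restrict id (carrier (fst A))"
  assumes F: "category_functor C C Fo (\<lambda>A B f. f)" and C: "C = weighted_module_category G \<alpha> a \<theta> pp p \<chi>"
    and same: "\<And>A. A \<in> Obj C \<Longrightarrow> same_weighted_module a \<theta> pp p A (Fo A)"
  shows "natural_isomorphism C C (\<lambda>A. A) (\<lambda>A B f. f) Fo (\<lambda>A B f. f) \<iota>"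
    and "natural_isomorphism C C Fo (\<lambda>A B f. f) (\<lambda>A. A) (\<lambda>A B f. f) \<iota>"
proof -
  have obj: "Fo A \<in> Obj C" if "A \<in> Obj C" for A
    using category_functor.obj_map[OF F that] .
  have same': "same_weighted_module a \<theta> pp p (Fo A) A" "carrier (fst (Fo A)) = carrier (fst A)"
    if "A \<in> Obj C" for A
    using same[OF that] by (simp_all add: same_weighted_module_def)
  have iso: "isomorphism_in C A (Fo A) (\<iota> A)" "isomorphism_in C (Fo A) A (\<iota> A)" if "A \<in> Obj C" for A
  proof -
    have A: "is_weighted_module G \<alpha> a \<theta> pp p \<chi> A" "is_weighted_module G \<alpha> a \<theta> pp p \<chi> (Fo A)"
      using that obj[OF that] by (simp_all add: C)
    show "isomorphism_in C A (Fo A) (\<iota> A)"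
      unfolding C \<iota>_def by (rule restrict_id_iso[OF A same[OF that]])
    have "\<iota> A = restrict id (carrier (fst (Fo A)))"
      using same'(2)[OF that] by (simp add: \<iota>_def)
    then show "isomorphism_in C (Fo A) A (\<iota> A)"
      unfolding C using restrict_id_iso[OF A(2,1) same'(1)[OF that]] by simp
  qed
  have nat: "compose (carrier (fst A)) (\<iota> B) f = compose (carrier (fst A)) f (\<iota> A)"
    if "A \<in> Obj C" "B \<in> Obj C" "f \<in> Hom C A B" for A B f
    using that by (auto simp: C \<iota>_def weighted_module_hom_iff compose_def fun_eq_iff)
  have cat: "category C" unfolding C by (rule category_weighted_module_category)
  show "natural_isomorphism C C (\<lambda>A. A) (\<lambda>A B f. f) Fo (\<lambda>A B f. f) \<iota>"
    by (intro natural_isomorphism.intro natural_isomorphism_axioms.intro category_functor_id cat F iso)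
      (use nat in \<open>auto simp: C\<close>)
  show "natural_isomorphism C C Fo (\<lambda>A B f. f) (\<lambda>A. A) (\<lambda>A B f. f) \<iota>"
    by (intro natural_isomorphism.intro natural_isomorphism_axioms.intro category_functor_id cat F iso)
      (use nat same'(2) in \<open>auto simp: C\<close>)
qed

section \<open>The twisting functor\<close>

context twisting
begin

abbreviation "Tw \<equiv> twisted_module G \<alpha> a \<theta> pp p \<theta>' pp' p' c"

lemma twisted_weighted_moduleI:
  "is_weighted_module G \<alpha> a \<theta> pp p \<chi> B
    \<Longrightarrow> twisted_weighted_module a \<alpha> G \<theta> \<theta>' pp pp' p p' \<sigma> \<tau> A \<eta> \<epsilon> x y \<chi> (fst B) (snd B)"
  by (intro twisted_weighted_module.intro twisting_axioms weighted_moduleI)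

text \<open>A homomorphism preserves weights, so on a weight space both twisted actions are the
  original actions of the same twisted element, with which it commutes. Additivity extends this to
  the whole module, so the functor can keep the underlying function.\<close>

lemma twisted_module_hom:
  assumes B: "is_weighted_module G \<alpha> a \<theta> pp p \<chi> B" and B': "is_weighted_module G \<alpha> a \<theta> pp p \<chi> B'"
    and f: "f \<in> weighted_module_hom G a \<theta> pp p B B'"
  shows "f \<in> weighted_module_hom G a \<theta>' pp' p' (Tw B) (Tw B')"
proof -
  interpret B: twisted_weighted_module a \<alpha> G \<theta> \<theta>' pp pp' p p' \<sigma> \<tau> A \<eta> \<epsilon> x y \<chi> "fst B" "snd B"
    by (rule twisted_weighted_moduleI[OF B])
  interpret B': twisted_weighted_module a \<alpha> G \<theta> \<theta>' pp pp' p p' \<sigma> \<tau> A \<eta> \<epsilon> x y \<chi> "fst B'" "snd B'"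
    by (rule twisted_weighted_moduleI[OF B'])
  have f: "\<And>v. v \<in> carrier (fst B) \<Longrightarrow> f v \<in> carrier (fst B')"
      "\<And>v w. \<lbrakk>v \<in> carrier (fst B); w \<in> carrier (fst B)\<rbrakk> \<Longrightarrow> f (v \<oplus>\<^bsub>fst B\<^esub> w) = f v \<oplus>\<^bsub>fst B'\<^esub> f w"
      "\<And>z v. v \<in> carrier (fst B) \<Longrightarrow> f (B.act z v) = B'.act z (f v)"
      "\<And>\<mu> v. \<lbrakk>\<mu> \<in> G; v \<in> snd B \<mu>\<rbrakk> \<Longrightarrow> f v \<in> snd B' \<mu>"
      "f \<in> carrier (fst B) \<rightarrow>\<^sub>E carrier (fst B')"
    using f by (auto simp: weighted_module_hom_iff)
  have "f (B.tact z v) = B'.tact z (f v)" if "v \<in> carrier (fst B)" for z v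
  proof (rule B.additive_eqI[OF B'.M.abelian_group_axioms _ _ _ _ _ that,
        where f = "\<lambda>v. f (B.tact z v)" and g = "\<lambda>v. B'.tact z (f v)"])
    show "f (B.tact z v) = B'.tact z (f v)" if "\<mu> \<in> G" "v \<in> snd B \<mu>" for \<mu> v
      by (simp only: B.tact_homogeneous[OF that] B'.tact_homogeneous[OF that(1) f(4)[OF that]]
          f(3)[OF B.V_closed[OF that]])
  qed (use f B.tact_closed B'.tact_closed B.tact_add_right B'.tact_add_right in simp_all)
  then show ?thesis using f by (simp add: weighted_module_hom_iff)
qed

lemma twisted_module_functor:
  assumes \<chi>': "\<And>i \<mu>. \<mu> \<in> G \<Longrightarrow> \<chi>' i \<mu> = \<epsilon> i \<mu> * \<chi> i \<mu>"
  shows "category_functor (weighted_module_category G \<alpha> a \<theta> pp p \<chi>)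
    (weighted_module_category G \<alpha> a \<theta>' pp' p' \<chi>') Tw (\<lambda>A B f. f)"
proof (intro category_functor.intro category_functor_axioms.intro category_weighted_module_category)
  fix B assume "B \<in> Obj (weighted_module_category G \<alpha> a \<theta> pp p \<chi>)"
  then have "twisted_weighted_module a \<alpha> G \<theta> \<theta>' pp pp' p p' \<sigma> \<tau> A \<eta> \<epsilon> x y \<chi> (fst B) (snd B)"
    by (simp add: twisted_weighted_moduleI)
  from twisted_weighted_module.weighted_N[OF this \<chi>']
  show "Tw B \<in> Obj (weighted_module_category G \<alpha> a \<theta>' pp' p' \<chi>')" by simp
qed (simp_all add: twisted_module_hom)

end

theorem proposition2p7:
  fixes a :: "'i \<Rightarrow> 'i \<Rightarrow> int"
    and \<alpha> :: "'i \<Rightarrow> 'p::ab_group_add"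
    and h :: "'i \<Rightarrow> 'p \<Rightarrow> int"
    and G :: "'p set"
    and \<theta> \<theta>' pp pp' :: "'i \<Rightarrow> 'i \<Rightarrow> 'k::comm_ring_1"
    and p p' :: "'i \<Rightarrow> 'k"
    and \<chi> \<chi>' :: "'i \<Rightarrow> 'p \<Rightarrow> 'k"
  assumes "cartan_datum a \<alpha> h"
    and "\<And>\<mu> \<beta>. \<mu> \<in> G \<Longrightarrow> \<beta> \<in> root_lattice \<alpha> \<Longrightarrow> \<mu> + \<beta> \<in> G"
    and "admissible_parameters a \<theta> pp p"
    and "admissible_parameters a \<theta>' pp' p'"
    and "\<And>i. (p i)\<^sup>2 = (p' i)\<^sup>2"
    and "weight_characters \<alpha> h G pp p \<chi>"
    and "weight_characters \<alpha> h G pp' p' \<chi>'"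
  shows "equivalent_categories
    (weighted_module_category G \<alpha> a \<theta> pp p \<chi>
      :: (('i, 'k, 'p, 'm) weighted_module, 'm \<Rightarrow> 'm) category)
    (weighted_module_category G \<alpha> a \<theta>' pp' p' \<chi>'
      :: (('i, 'k, 'p, 'm) weighted_module, 'm \<Rightarrow> 'm) category)"
proof (rule ex_twisting[OF assms])
  fix \<sigma> \<tau> A \<eta> \<epsilon> x y
  assume T: "twisting a \<alpha> G \<theta> \<theta>' pp pp' p p' \<sigma> \<tau> A \<eta> \<epsilon> x y"
    and \<chi>': "\<And>i \<mu>. \<mu> \<in> G \<Longrightarrow> \<chi>' i \<mu> = \<epsilon> i \<mu> * \<chi> i \<mu>"
  interpret T: twisting a \<alpha> G \<theta> \<theta>' pp pp' p p' \<sigma> \<tau> A \<eta> \<epsilon> x y by (rule T)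
  let ?x' = "\<lambda>i \<mu>. unit_inv (x i \<mu>)" and ?y' = "\<lambda>i \<mu>. \<epsilon> i \<mu> * \<eta> i * x i (\<mu> - \<alpha> i)"
  interpret T': twisting a \<alpha> G \<theta>' \<theta> pp' pp p' p \<sigma> "\<lambda>i j. unit_inv (\<tau> i j)" "\<lambda>i j. unit_inv (A i j)" \<eta> \<epsilon> ?x' ?y'
    by (rule T.twisting_inverse)
  \<comment> \<open>Since \<epsilon> has square 1, the same family relates the characters in the
    opposite direction, as the functor back requires.\<close>
  have \<chi>: "\<chi> i \<mu> = \<epsilon> i \<mu> * \<chi>' i \<mu>" if "\<mu> \<in> G" for i \<mu>
    by (simp add: \<chi>' that T.sign_cancel T.\<epsilon>)
  let ?C = "weighted_module_category G \<alpha> a \<theta> pp p \<chi> :: (('i, 'k, 'p, 'm) weighted_module, 'm \<Rightarrow> 'm) category"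
  let ?D = "weighted_module_category G \<alpha> a \<theta>' pp' p' \<chi>' :: (('i, 'k, 'p, 'm) weighted_module, 'm \<Rightarrow> 'm) category"
  have F: "category_functor ?C ?D T.Tw (\<lambda>A B f. f)" and F': "category_functor ?D ?C T'.Tw (\<lambda>A B f. f)"
    by (rule T.twisted_module_functor[OF \<chi>'] T'.twisted_module_functor[OF \<chi>]; assumption)+
  have obj: "B \<in> Obj ?C \<Longrightarrow> T.Tw B \<in> Obj ?D" "B \<in> Obj ?D \<Longrightarrow> T'.Tw B \<in> Obj ?C" for B
    by (erule category_functor.obj_map[OF F] category_functor.obj_map[OF F'])+
  note inv = T.letter_twist_inverse
  have inv': "T'.c g \<mu> * T.c g \<mu> = 1" if "\<mu> \<in> G" for g \<mu>
    using inv[OF that] by (simp only: mult.commute)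
  have pair: "(fst B, snd B) = B" "(fst (T.Tw B), snd B) = T.Tw B" "(fst (T'.Tw B), snd B) = T'.Tw B" for B
    by (simp_all add: prod_eq_iff)
  have "same_weighted_module a \<theta> pp p B (T'.Tw (T.Tw B))" if B: "B \<in> Obj ?C" for B
  proof -
    have 1: "twisted_weighted_module a \<alpha> G \<theta> \<theta>' pp pp' p p' \<sigma> \<tau> A \<eta> \<epsilon> x y \<chi> (fst B) (snd B)"
      using T.twisted_weighted_moduleI B by simp
    have 2: "twisted_weighted_module a \<alpha> G \<theta>' \<theta> pp' pp p' p \<sigma> (\<lambda>i j. unit_inv (\<tau> i j))
        (\<lambda>i j. unit_inv (A i j)) \<eta> \<epsilon> ?x' ?y' \<chi>' (fst (T.Tw B)) (snd B)"
      using T'.twisted_weighted_moduleI[of \<chi>' "T.Tw B"] obj(1)[OF B] by simp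
    have 3: "fst (T.Tw B) = fst (T.Tw (fst B, snd B))" by simp
    show ?thesis
      using twisted_module_inverse[OF 1 2 3 inv, unfolded pair] by (simp add: same_weighted_module_def)
  qed
  note iso = natural_isomorphism_restrict_id(1)[OF category_functor_comp[OF F F'] refl this]
  have "same_weighted_module a \<theta>' pp' p' B (T.Tw (T'.Tw B))" if B: "B \<in> Obj ?D" for B
  proof -
    have 1: "twisted_weighted_module a \<alpha> G \<theta>' \<theta> pp' pp p' p \<sigma> (\<lambda>i j. unit_inv (\<tau> i j))
        (\<lambda>i j. unit_inv (A i j)) \<eta> \<epsilon> ?x' ?y' \<chi>' (fst B) (snd B)"
      using T'.twisted_weighted_moduleI B by simp
    have 2: "twisted_weighted_module a \<alpha> G \<theta> \<theta>' pp pp' p p' \<sigma> \<tau> A \<eta> \<epsilon> x y \<chi> (fst (T'.Tw B)) (snd B)"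
      using T.twisted_weighted_moduleI[of \<chi> "T'.Tw B"] obj(2)[OF B] by simp
    have 3: "fst (T'.Tw B) = fst (T'.Tw (fst B, snd B))" by simp
    show ?thesis
      using twisted_module_inverse[OF 1 2 3 inv', unfolded pair] by (simp add: same_weighted_module_def)
  qed
  note iso' = natural_isomorphism_restrict_id(2)[OF category_functor_comp[OF F' F] refl this]
  show ?thesis
    unfolding equivalent_categories_def using F F' iso iso' by blast
qed

end
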